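(* Let $G=(V,E)$ be a graph with $|E|\geq 1$, and assume that $I_G$ satisfies property $N_1$. Then $G$ is a $(K_4,K_4\setminus e,C_4)$-combinatorial retract-free graph.
   Context: $\mathbb{K}$ is a field. All graphs are finite and simple with non-empty vertex set. $K_4$ is the complete graph on $4$ vertices, $K_4\setminus e$ is $K_4$ with one edge deleted, $C_4$ is the $4$-cycle. For a graph $G=(V,E)$ let $S_G=\mathbb{K}[q_{A|B}]$ be the polynomial ring with one variable for each unordered partition $A|B$ of $V$ (i.e. $A\cup B=V$, $A\cap B=\emptyset$, empty parts allowed), standard graded, and $R_G=\mathbb{K}[s_{ij},t_{ij}:\{i,j\}\in E]$. Let $\mathrm{Cut}(A|B)\subseteq E$ be the set of edges with one endpoint in $A$ and the other in $B$. Let $\phi_G\colon S_G\to R_G$ be the $\mathbb{K}$-algebra homomorphism $q_{A|B}\mapsto \prod_{\{i,j\}\in \mathrm{Cut}(A|B)}s_{ij}\prod_{\{i,j\}\in E\setminus \mathrm{Cut}(A|B)}t_{ij}$. The cut ideal is the graded ideal $I_G=\ker\phi_G$. Property $N_p$: a nonzero graded ideal $I$ in a polynomial ring $R$ over $\mathbb{K}$ satisfies property $N_p$ if it is generated in degree $2$ and its minimal graded free resolution is linear up to homological degree $p$, i.e. $\beta_{i,i+j}^R(I)=\dim_{\mathbb{K}}\mathrm{Tor}_i^R(\mathbb{K},I)_{i+j}=0$ for all $i\leq p$ and all $j\neq 2$. $N_G(v)$ is the set of neighbors of $v$, $N_G[v]=N_G(v)\cup\{v\}$, $N_G(T)=\bigcup_{v\in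 T}N_G(v)$, and $G_W$ is the induced subgraph on $W$. Edge contraction: for $e=\{u,v\}\in E$, the contracted graph has vertex set $V'=(V\setminus\{u,v\})\cup\{w\}$ with $w$ new and edge set $\{f\in E: f\cap\{u,v\}=\emptyset\}\cup\{\{w,z\}: z\in V\setminus\{u,v\},\ z \text{ adjacent to } u \text{ or } v\}$. Neighborhood-minor: if $V=W\cup W'$ with $W\cap W'=\emptyset$, $W,W'\neq\emptyset$, $H=G_W$, and there is a vertex $v\in W$ with $W\cap N_G(W')\subseteq N_H[v]$, then $H$ is a neighborhood-minor of $G$. Combinatorial retract: $G'$ is a combinatorial retract of $G$ if there is a sequence $G_0,\dots,G_r$ ($r\ge 0$) of graphs with $G_0=G$, $G_r=G'$ such that for each $i=1,\dots,r$, $G_i$ is either obtained by an edge contraction from $G_{i-1}$ or is a neighborhood-minor of $G_{i-1}$. $G$ is $(H_1,\dots,H_t)$-combinatorial retract-free if it has no combinatorial retract isomorphic to any of $H_1,\dots,H_t$. *)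

theory Defs
  imports
    "HOL-Library.Poly_Mapping"
    "HOL-Algebra.Ideal"
    "HOL-Algebra.RingHom"
    "Jordan_Normal_Form.Matrix"
begin

section \<open>Graphs\<close>

record 'v graph =
  verts :: "'v set"
  edges :: "'v set set"

definition simple_graph :: "'v graph \<Rightarrow> bool" where
  "simple_graph G \<longleftrightarrow> finite (verts G) \<and> verts G \<noteq> {} \<and>
     (\<forall>e\<in>edges G. \<exists>u\<in>verts G. \<exists>v\<in>verts G. u \<noteq> v \<and> e = {u, v})"

definition nbrs :: "'v graph \<Rightarrow> 'v \<Rightarrow> 'v set" where
  "nbrs G v = {u \<in> verts G. {u, v} \<in> edges G}"

definition closed_nbrs :: "'v graph \<Rightarrow> 'v \<Rightarrow> 'v set" where
  "closed_nbrs G v = nbrs G v \<union> {v}"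

definition nbrs_of :: "'v graph \<Rightarrow> 'v set \<Rightarrow> 'v set" where
  "nbrs_of G T = (\<Union>v\<in>T. nbrs G v)"

definition induced_subgraph :: "'v graph \<Rightarrow> 'v set \<Rightarrow> 'v graph" where
  "induced_subgraph G W = \<lparr>verts = W, edges = {e \<in> edges G. e \<subseteq> W}\<rparr>"

definition graph_iso :: "'v graph \<Rightarrow> 'w graph \<Rightarrow> bool" where
  "graph_iso G H \<longleftrightarrow>
     (\<exists>f. bij_betw f (verts G) (verts H) \<and> edges H = (\<lambda>e. f ` e) ` edges G)"

text \<open>
  The vertex \<open>w\<close> replacing the contracted edge may be any element of the vertex type that is
  not one of the surviving vertices. In particular it may be \<open>u\<close> or \<open>v\<close> itself, so that
  contractions exist even when the vertex type is exhausted by the graph. Different choices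
  of \<open>w\<close> give isomorphic graphs.
\<close>
definition contract_edge :: "'v graph \<Rightarrow> 'v \<Rightarrow> 'v \<Rightarrow> 'v \<Rightarrow> 'v graph" where
  "contract_edge G u v w =
     \<lparr>verts = insert w (verts G - {u, v}),
      edges = {f \<in> edges G. f \<inter> {u, v} = {}} \<union>
              {{w, z} | z. z \<in> verts G - {u, v} \<and> ({z, u} \<in> edges G \<or> {z, v} \<in> edges G)}\<rparr>"

definition edge_contraction :: "'v graph \<Rightarrow> 'v graph \<Rightarrow> bool" where
  "edge_contraction G G' \<longleftrightarrow>
     (\<exists>u v w. u \<noteq> v \<and> {u, v} \<in> edges G \<and> w \<notin> verts G - {u, v} \<and> G' = contract_edge G u v w)"

definition neighborhood_minor :: "'v graph \<Rightarrow> 'v graph \<Rightarrow> bool" where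
  "neighborhood_minor G H \<longleftrightarrow>
     (\<exists>W W'. verts G = W \<union> W' \<and> W \<inter> W' = {} \<and> W \<noteq> {} \<and> W' \<noteq> {} \<and>
        H = induced_subgraph G W \<and>
        (\<exists>v\<in>W. W \<inter> nbrs_of G W' \<subseteq> closed_nbrs H v))"

definition combinatorial_retract :: "'v graph \<Rightarrow> 'v graph \<Rightarrow> bool" where
  "combinatorial_retract G G' \<longleftrightarrow>
     (\<lambda>H H'. edge_contraction H H' \<or> neighborhood_minor H H')\<^sup>*\<^sup>* G G'"

definition combinatorial_retract_free :: "'v graph \<Rightarrow> 'w graph set \<Rightarrow> bool" where
  "combinatorial_retract_free G \<H> \<longleftrightarrow>
     (\<forall>H\<in>\<H>. \<not> (\<exists>G'. combinatorial_retract G G' \<and> graph_iso G' H))"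

definition K4 :: "nat graph" where
  "K4 = \<lparr>verts = {0, 1, 2, 3}, edges = {{0, 1}, {0, 2}, {0, 3}, {1, 2}, {1, 3}, {2, 3}}\<rparr>"

definition K4_minus_edge :: "nat graph" where
  "K4_minus_edge = \<lparr>verts = verts K4, edges = edges K4 - {{0, 1}}\<rparr>"

definition C4 :: "nat graph" where
  "C4 = \<lparr>verts = {0, 1, 2, 3}, edges = {{0, 1}, {1, 2}, {2, 3}, {3, 0}}\<rparr>"


section \<open>Polynomial rings\<close>

text \<open>
  A polynomial is a finitely supported map from monomials (finitely supported exponent
  vectors) to coefficients. The type admits all elements of \<open>'x\<close> as variables; the polynomial
  ring in a given set \<open>X\<close> of variables is the carrier of \<open>poly_ring X\<close>.
\<close>
type_synonym ('x, 'k) mpoly = "('x \<Rightarrow>\<^sub>0 nat) \<Rightarrow>\<^sub>0 'k"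

definition poly_ring :: "'x set \<Rightarrow> ('x, 'k::field) mpoly ring" where
  "poly_ring X =
     \<lparr>carrier = {p. \<forall>m\<in>Poly_Mapping.keys p. Poly_Mapping.keys m \<subseteq> X},
      monoid.mult = (*), one = 1, zero = 0, add = (+)\<rparr>"

definition pconst :: "'k::field \<Rightarrow> ('x, 'k) mpoly" where
  "pconst c = Poly_Mapping.single 0 c"

definition pvar :: "'x \<Rightarrow> ('x, 'k::field) mpoly" where
  "pvar x = Poly_Mapping.single (Poly_Mapping.single x 1) 1"

definition mdeg :: "('x \<Rightarrow>\<^sub>0 nat) \<Rightarrow> nat" where
  "mdeg m = (\<Sum>x\<in>Poly_Mapping.keys m. Poly_Mapping.lookup m x)"

definition homogeneous :: "nat \<Rightarrow> ('x, 'k::field) mpoly \<Rightarrow> bool" where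
  "homogeneous d p \<longleftrightarrow> (\<forall>m\<in>Poly_Mapping.keys p. mdeg m = d)"

definition poly_subst :: "('x \<Rightarrow> ('y, 'k::field) mpoly) \<Rightarrow> ('x, 'k) mpoly \<Rightarrow> ('y, 'k) mpoly" where
  "poly_subst f p = (\<Sum>m\<in>Poly_Mapping.keys p.
     pconst (Poly_Mapping.lookup p m) * (\<Prod>x\<in>Poly_Mapping.keys m. f x ^ Poly_Mapping.lookup m x))"


section \<open>Minimal graded free resolutions and property \<open>N\<^sub>p\<close>\<close>

text \<open>
  Data of a complex \<open>\<dots> \<rightarrow> F 2 \<rightarrow> F 1 \<rightarrow> F 0 \<rightarrow> I\<close> of graded free modules of finite rank over a
  polynomial ring \<open>R\<close>: \<open>F i\<close> is free on basis elements \<open>0, \<dots>, rk i - 1\<close>, the \<open>k\<close>-th of which has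
  degree \<open>gdeg i k\<close>, so \<open>F i\<close> is the direct sum of the shifted modules \<open>R(- gdeg i k)\<close>.
  The augmentation \<open>F 0 \<rightarrow> I\<close> is given by the vector \<open>aug\<close> of images of the basis elements, and
  \<open>F (i + 1) \<rightarrow> F i\<close> by the matrix \<open>diff i\<close>.
\<close>
record (overloaded) ('x, 'k) free_complex =
  rk :: "nat \<Rightarrow> nat"
  gdeg :: "nat \<Rightarrow> nat \<Rightarrow> nat"
  aug :: "('x, 'k) mpoly vec"
  diff :: "nat \<Rightarrow> ('x, 'k) mpoly mat"

definition free_mod :: "'x set \<Rightarrow> nat \<Rightarrow> ('x, 'k::field) mpoly vec set" where
  "free_mod X n = {v \<in> carrier_vec n. \<forall>k<n. v $ k \<in> carrier (poly_ring X)}"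

definition graded_maps :: "'x set \<Rightarrow> ('x, 'k::field) free_complex \<Rightarrow> bool" where
  "graded_maps X F \<longleftrightarrow>
     aug F \<in> free_mod X (rk F 0) \<and>
     (\<forall>k<rk F 0. homogeneous (gdeg F 0 k) (aug F $ k)) \<and>
     (\<forall>i. diff F i \<in> carrier_mat (rk F i) (rk F (Suc i)) \<and>
        (\<forall>r<rk F i. \<forall>c<rk F (Suc i).
           diff F i $$ (r, c) \<in> carrier (poly_ring X) \<and>
           (\<forall>m\<in>Poly_Mapping.keys (diff F i $$ (r, c)). gdeg F i r + mdeg m = gdeg F (Suc i) c)))"

definition graded_free_resolution ::
    "'x set \<Rightarrow> ('x, 'k::field) mpoly set \<Rightarrow> ('x, 'k) free_complex \<Rightarrow> bool" where
  "graded_free_resolution X I F \<longleftrightarrow>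
     graded_maps X F \<and>
     (\<lambda>v. aug F \<bullet> v) ` free_mod X (rk F 0) = I \<and>
     {v \<in> free_mod X (rk F 0). aug F \<bullet> v = 0} = (\<lambda>v. diff F 0 *\<^sub>v v) ` free_mod X (rk F 1) \<and>
     (\<forall>i. {v \<in> free_mod X (rk F (Suc i)). diff F i *\<^sub>v v = 0\<^sub>v (rk F i)} =
          (\<lambda>v. diff F (Suc i) *\<^sub>v v) ` free_mod X (rk F (Suc (Suc i))))"

text \<open>
  Minimality: every differential maps into the maximal ideal generated by the variables times
  the target, i.e. its matrix entries have no constant term.
\<close>
definition minimal_graded_free_resolution ::
    "'x set \<Rightarrow> ('x, 'k::field) mpoly set \<Rightarrow> ('x, 'k) free_complex \<Rightarrow> bool" where
  "minimal_graded_free_resolution X I F \<longleftrightarrow>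
     graded_free_resolution X I F \<and>
     (\<forall>i. \<forall>r<rk F i. \<forall>c<rk F (Suc i). Poly_Mapping.lookup (diff F i $$ (r, c)) 0 = 0)"

text \<open>
  The number of basis elements of degree \<open>d\<close> in homological degree \<open>i\<close>. For a minimal graded
  free resolution of \<open>I\<close>, tensoring with the residue field kills all differentials, so this is
  the dimension of the degree-\<open>d\<close> component of \<open>Tor\<^sub>i(K, I)\<close>, the graded Betti number
  \<open>\<beta>\<^sub>i\<^sub>,\<^sub>d(I)\<close>.
\<close>
definition graded_betti :: "('x, 'k::field) free_complex \<Rightarrow> nat \<Rightarrow> nat \<Rightarrow> nat" where
  "graded_betti F i d = card {k. k < rk F i \<and> gdeg F i k = d}"

text \<open>
  The total degree is \<open>d = i + j\<close>, so \<open>d \<noteq> i + 2\<close> expresses \<open>j \<noteq> 2\<close> (negative \<open>j\<close> included).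
  Minimal graded free resolutions exist and are unique up to isomorphism, so it does not
  matter which one is taken.
\<close>
definition property_N :: "'x set \<Rightarrow> nat \<Rightarrow> ('x, 'k::field) mpoly set \<Rightarrow> bool" where
  "property_N X p I \<longleftrightarrow>
     I \<noteq> {0} \<and>
     I = genideal (poly_ring X) {f \<in> I. homogeneous 2 f} \<and>
     (\<exists>F. minimal_graded_free_resolution X I F \<and>
        (\<forall>i\<le>p. \<forall>d. d \<noteq> i + 2 \<longrightarrow> graded_betti F i d = 0))"


section \<open>Cut ideals\<close>

text \<open>The unordered partition \<open>A|B\<close> is the set \<open>{A, B}\<close>.\<close>
definition vertex_partitions :: "'v graph \<Rightarrow> 'v set set set" where
  "vertex_partitions G = {{A, B} | A B. A \<union> B = verts G \<and> A \<inter> B = {}}"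

definition Cut :: "'v graph \<Rightarrow> 'v set set \<Rightarrow> 'v set set" where
  "Cut G \<pi> = {e \<in> edges G. \<exists>A B i j. \<pi> = {A, B} \<and> i \<in> A \<and> j \<in> B \<and> e = {i, j}}"

datatype 'e st_var = S_var 'e | T_var 'e

abbreviation st_vars :: "'v graph \<Rightarrow> 'v set st_var set" where
  "st_vars G \<equiv> S_var ` edges G \<union> T_var ` edges G"

definition cut_map :: "'v graph \<Rightarrow> ('v set set, 'k::field) mpoly \<Rightarrow> ('v set st_var, 'k) mpoly" where
  "cut_map G = poly_subst
     (\<lambda>\<pi>. (\<Prod>e\<in>Cut G \<pi>. pvar (S_var e)) * (\<Prod>e\<in>edges G - Cut G \<pi>. pvar (T_var e)))"

definition cut_ideal :: "'v graph \<Rightarrow> ('v set set, 'k::field) mpoly set" where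
  "cut_ideal G = a_kernel (poly_ring (vertex_partitions G)) (poly_ring (st_vars G)) (cut_map G)"

end

theory Submission
  imports Defs
begin

text \<open>
  A combinatorial retract \<open>H\<close> of \<open>G\<close> comes with a map \<open>p\<close> of vertices from \<open>G\<close> to \<open>H\<close>. Pulling
  partitions back along \<open>p\<close> sends binomials of \<open>I\<^sub>H\<close> to binomials of \<open>I\<^sub>G\<close>. In the other direction,
  restricting partitions along a section of \<open>p\<close>, and sending \<open>q\<^bsub>A|B\<^esub>\<close> to \<open>0\<close> if \<open>A|B\<close> cuts an edge
  collapsed by \<open>p\<close>, gives a ring homomorphism \<open>\<rho>\<close> that maps \<open>I\<^sub>G\<close> to \<open>I\<^sub>H\<close> and is a left inverse of the
  pullback.

  If \<open>H = K\<^sub>4\<close>, then \<open>I\<^sub>H\<close> contains no quadrics, so \<open>\<rho>\<close> kills the ideal generated by the quadrics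
  of \<open>I\<^sub>G\<close>, but not the pullback of the quartic generator of \<open>I\<^sub>H\<close>. In the other two cases \<open>I\<^sub>H\<close> is a
  complete intersection of quadrics. There are variables \<open>x \<noteq> y\<close> such that, in every quadric of \<open>I\<^sub>H\<close>,
  \<open>x y\<close> is the only monomial involving \<open>x\<close> or \<open>y\<close>. Let \<open>a\<^sub>k\<close> be the coefficient of \<open>x y\<close> in
  \<open>\<rho> u\<^sub>k\<close>, for quadratic generators \<open>u\<^sub>k\<close> of \<open>I\<^sub>G\<close>. Then \<open>\<Sum> a\<^sub>k \<rho> s\<^sub>k = 0\<close> for every linear syzygy
  \<open>s\<close>, hence for every syzygy if the resolution is linear in the first step; but this fails for the
  Koszul syzygy of the pullbacks of two generators of \<open>I\<^sub>H\<close>.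
\<close>

section \<open>Substitution homomorphisms\<close>

lemma mpoly_induct [case_names zero monom add]:
  assumes "P 0" and "\<And>m c. P (Poly_Mapping.single m c)"
    and "\<And>p q. P p \<Longrightarrow> P q \<Longrightarrow> P (p + q)"
  shows "P (p :: ('x, 'k::field) mpoly)"
proof -
  have "P (\<Sum>m\<in>A. Poly_Mapping.single m (Poly_Mapping.lookup p m))" if "finite A" for A
    using that by induction (auto intro: assms)
  moreover have "p = (\<Sum>m\<in>Poly_Mapping.keys p. Poly_Mapping.single m (Poly_Mapping.lookup p m))"
    by (rule poly_mapping_eqI)
      (auto simp: lookup_sum lookup_single when_def sum.delta in_keys_iff)
  ultimately show ?thesis by (metis finite_keys)
qed

lemma pconst_simps:
  "pconst 0 = 0" "pconst 1 = 1" "pconst (a + b) = pconst a + pconst b"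
  "pconst (a * b) = pconst a * pconst b"
  by (simp_all add: pconst_def single_add mult_single)

definition monom_subst :: "('x \<Rightarrow> 'a::comm_monoid_mult) \<Rightarrow> ('x \<Rightarrow>\<^sub>0 nat) \<Rightarrow> 'a" where
  "monom_subst f m = (\<Prod>x\<in>Poly_Mapping.keys m. f x ^ Poly_Mapping.lookup m x)"

lemma monom_subst_superset:
  assumes "finite A" "Poly_Mapping.keys m \<subseteq> A"
  shows "monom_subst f m = (\<Prod>x\<in>A. f x ^ Poly_Mapping.lookup m x)"
  unfolding monom_subst_def using assms
  by (intro prod.mono_neutral_left) (auto simp: in_keys_iff)

lemma monom_subst_0 [simp]: "monom_subst f 0 = 1"
  by (simp add: monom_subst_def)

lemma monom_subst_single [simp]: "monom_subst f (Poly_Mapping.single x n) = f x ^ n"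
  by (simp add: monom_subst_def)

lemma monom_subst_add: "monom_subst f (m + n) = monom_subst f m * monom_subst f n"
proof -
  let ?A = "Poly_Mapping.keys m \<union> Poly_Mapping.keys n"
  have "monom_subst f (m + n) = (\<Prod>x\<in>?A. f x ^ Poly_Mapping.lookup (m + n) x)"
    by (intro monom_subst_superset keys_add) auto
  also have "\<dots> = monom_subst f m * monom_subst f n"
    by (simp add: monom_subst_superset[of ?A] lookup_add power_add prod.distrib)
  finally show ?thesis .
qed

lemma poly_subst_eq:
  "poly_subst f p = (\<Sum>m\<in>Poly_Mapping.keys p. pconst (Poly_Mapping.lookup p m) * monom_subst f m)"
  by (simp add: poly_subst_def monom_subst_def)

lemma poly_subst_0 [simp]: "poly_subst f 0 = 0"
  by (simp add: poly_subst_def)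

lemma poly_subst_single: "poly_subst f (Poly_Mapping.single m c) = pconst c * monom_subst f m"
  by (cases "c = 0") (simp_all add: poly_subst_eq pconst_simps)

lemma poly_subst_1 [simp]: "poly_subst f 1 = 1"
  using poly_subst_single[of f 0 1] by (simp add: pconst_simps)

lemma poly_subst_pvar [simp]: "poly_subst f (pvar x) = f x"
  by (simp add: pvar_def poly_subst_single pconst_simps)

lemma poly_subst_add: "poly_subst f (p + q) = poly_subst f p + poly_subst f q"
  unfolding poly_subst_eq
  by (rule setsum_keys_plus_distrib) (simp_all add: pconst_simps algebra_simps)

lemma poly_subst_mult: "poly_subst f (p * q) = poly_subst f p * poly_subst f q"
proof (induction p rule: mpoly_induct)
  case (monom m c)
  show ?case
    by (induction q rule: mpoly_induct)
      (simp_all add: poly_subst_single mult_single monom_subst_add pconst_simps poly_subst_add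
        algebra_simps)
qed (simp_all add: poly_subst_add algebra_simps)

lemma poly_subst_minus: "poly_subst f (p - q) = poly_subst f p - poly_subst f q"
proof -
  have "poly_subst f p = poly_subst f ((p - q) + q)" by simp
  then show ?thesis unfolding poly_subst_add by simp
qed

lemma poly_subst_sum: "poly_subst f (\<Sum>i\<in>A. g i) = (\<Sum>i\<in>A. poly_subst f (g i))"
  by (induction A rule: infinite_finite_induct) (simp_all add: poly_subst_add)

lemma poly_subst_prod: "poly_subst f (\<Prod>i\<in>A. g i) = (\<Prod>i\<in>A. poly_subst f (g i))"
  by (induction A rule: infinite_finite_induct) (simp_all add: poly_subst_mult)

lemma poly_subst_prod_list: "poly_subst f (prod_list ps) = (\<Prod>p\<leftarrow>ps. poly_subst f p)"
  by (induction ps) (simp_all add: poly_subst_mult)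

lemma poly_subst_power: "poly_subst f (p ^ n) = poly_subst f p ^ n"
  by (induction n) (simp_all add: poly_subst_mult)

lemma poly_subst_pconst [simp]: "poly_subst f (pconst c) = pconst c"
  by (simp add: pconst_def poly_subst_single)

lemma poly_subst_poly_subst:
  "poly_subst g (poly_subst f p) = poly_subst (\<lambda>x. poly_subst g (f x)) p"
  by (simp add: poly_subst_eq[of f] poly_subst_eq[of "\<lambda>x. poly_subst g (f x)"]
      poly_subst_sum poly_subst_mult monom_subst_def poly_subst_prod poly_subst_power)

lemma poly_subst_cong:
  assumes "p \<in> carrier (poly_ring X)" and "\<And>x. x \<in> X \<Longrightarrow> f x = g x"
  shows "poly_subst f p = poly_subst g p"
proof -
  have "f x = g x" if "m \<in> Poly_Mapping.keys p" "x \<in> Poly_Mapping.keys m" for m x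
    using assms that by (auto simp: poly_ring_def)
  then show ?thesis
    unfolding poly_subst_def by (intro sum.cong arg_cong2[where f = "(*)"] prod.cong refl) simp
qed

section \<open>Degrees of monomials and homogeneous polynomials\<close>

lemma mdeg_superset:
  assumes "finite A" "Poly_Mapping.keys m \<subseteq> A"
  shows "mdeg m = (\<Sum>x\<in>A. Poly_Mapping.lookup m x)"
  unfolding mdeg_def using assms
  by (intro sum.mono_neutral_left) (auto simp: in_keys_iff)

lemma mdeg_add: "mdeg (m + n) = mdeg m + mdeg n"
proof -
  let ?A = "Poly_Mapping.keys m \<union> Poly_Mapping.keys n"
  have "mdeg (m + n) = (\<Sum>x\<in>?A. Poly_Mapping.lookup (m + n) x)"
    by (intro mdeg_superset keys_add) auto
  then show ?thesis
    by (simp add: mdeg_superset[of ?A] lookup_add sum.distrib)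
qed

lemma mdeg_0 [simp]: "mdeg 0 = 0"
  by (simp add: mdeg_def)

lemma mdeg_single [simp]: "mdeg (Poly_Mapping.single x n) = n"
  by (simp add: mdeg_def)

lemma mdeg_eq_0: "mdeg m = 0 \<longleftrightarrow> m = 0"
  by (auto simp: mdeg_def in_keys_iff intro!: poly_mapping_eqI)

lemma mdeg_SucE:
  assumes "mdeg m = Suc d"
  obtains x n where "m = Poly_Mapping.single x 1 + n" "mdeg n = d"
proof -
  obtain x where x: "Poly_Mapping.lookup m x \<noteq> 0"
    using assms mdeg_eq_0[of m] by (metis nat.distinct(1) poly_mapping_eqI lookup_zero)
  then have m: "m = Poly_Mapping.single x 1 + (m - Poly_Mapping.single x 1)"
    by (intro poly_mapping_eqI) (auto simp: lookup_add lookup_minus lookup_single when_def)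
  have "mdeg m = 1 + mdeg (m - Poly_Mapping.single x 1)"
    by (subst m, subst mdeg_add) simp
  then show ?thesis using that m assms by simp
qed

lemma mdeg_1E:
  assumes "mdeg m = 1"
  obtains x where "m = Poly_Mapping.single x 1"
proof -
  from assms obtain x n where "m = Poly_Mapping.single x 1 + n" "mdeg n = 0"
    using mdeg_SucE[of m 0] by auto
  then show ?thesis using that by (simp add: mdeg_eq_0)
qed

lemma mdeg_2E:
  assumes "mdeg m = 2"
  obtains x y where "m = Poly_Mapping.single x 1 + Poly_Mapping.single y 1"
proof -
  from assms obtain x n where "m = Poly_Mapping.single x 1 + n" "mdeg n = 1"
    using mdeg_SucE[of m 1] by auto
  then show ?thesis using that by (metis mdeg_1E)
qed

lemma homogeneous_0 [simp]: "homogeneous d 0"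
  by (simp add: homogeneous_def)

lemma homogeneous_1 [simp]: "homogeneous 0 1"
  by (simp add: homogeneous_def)

lemma homogeneous_pconst: "homogeneous 0 (pconst c)"
  by (simp add: homogeneous_def pconst_def)

lemma homogeneous_pvar: "homogeneous 1 (pvar x)"
  by (simp add: homogeneous_def pvar_def)

lemma homogeneous_add: "homogeneous d p \<Longrightarrow> homogeneous d q \<Longrightarrow> homogeneous d (p + q)"
  using keys_add[of p q] by (auto simp: homogeneous_def)

lemma homogeneous_minus: "homogeneous d p \<Longrightarrow> homogeneous d q \<Longrightarrow> homogeneous d (p - q)"
  by (fastforce simp: homogeneous_def in_keys_iff lookup_minus)

lemma homogeneous_mult: "homogeneous d p \<Longrightarrow> homogeneous e q \<Longrightarrow> homogeneous (d + e) (p * q)"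
  using keys_mult[of p q] by (fastforce simp: homogeneous_def mdeg_add)

lemma homogeneous_sum: "(\<And>i. i \<in> A \<Longrightarrow> homogeneous d (f i)) \<Longrightarrow> homogeneous d (\<Sum>i\<in>A. f i)"
  by (induction A rule: infinite_finite_induct) (auto intro: homogeneous_add)

lemma homogeneous_power: "homogeneous d p \<Longrightarrow> homogeneous (d * n) (p ^ n)"
  by (induction n) (auto dest: homogeneous_mult)

lemma homogeneous_prod:
  "(\<And>i. i \<in> A \<Longrightarrow> homogeneous (d i) (f i)) \<Longrightarrow> homogeneous (\<Sum>i\<in>A. d i) (\<Prod>i\<in>A. f i)"
  by (induction A rule: infinite_finite_induct) (auto intro: homogeneous_mult)

lemma homogeneous_poly_subst:
  assumes "homogeneous d p" and "\<And>x. homogeneous 1 (f x)"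
  shows "homogeneous d (poly_subst f p)"
  unfolding poly_subst_eq
proof (rule homogeneous_sum)
  fix m assume "m \<in> Poly_Mapping.keys p"
  then have "mdeg m = d" using assms(1) by (simp add: homogeneous_def)
  moreover have "homogeneous (mdeg m) (monom_subst f m)"
    unfolding monom_subst_def mdeg_def
    by (rule homogeneous_prod) (use homogeneous_power[OF assms(2)] in simp)
  ultimately show "homogeneous d (pconst (Poly_Mapping.lookup p m) * monom_subst f m)"
    using homogeneous_mult[OF homogeneous_pconst] by fastforce
qed

lemma lookup_single_times:
  "Poly_Mapping.lookup (Poly_Mapping.single m c * p) (m + n) = c * Poly_Mapping.lookup p n"
  for p :: "('x, 'k::field) mpoly"
  by (induction p rule: mpoly_induct)
    (auto simp: mult_single lookup_single when_def lookup_add distrib_left)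

lemma lookup_pconst_times:
  "Poly_Mapping.lookup (pconst c * p) n = c * Poly_Mapping.lookup p n"
  using lookup_single_times[of 0 c p n] by (simp add: pconst_def)

text \<open>A nonconstant term of \<open>p\<close> lifts \<open>q\<close> into degrees above
  \<open>d\<close>, so degree \<open>d\<close> sees only the constant term of
  \<open>p\<close>.\<close>

lemma lookup_times_homogeneous:
  assumes "homogeneous d q" "mdeg m = d"
  shows "Poly_Mapping.lookup (p * q) m = Poly_Mapping.lookup p 0 * Poly_Mapping.lookup q m"
proof (induction p rule: mpoly_induct)
  case (monom n c)
  show ?case
  proof (cases "n = 0")
    case True
    then show ?thesis by (simp add: lookup_pconst_times lookup_single flip: pconst_def) (simp add: pconst_def)
  next
    case False
    then have "mdeg n > 0" by (metis mdeg_eq_0 gr0I)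
    moreover have "homogeneous (mdeg n + d) (Poly_Mapping.single n c * q)"
      by (intro homogeneous_mult assms) (simp add: homogeneous_def)
    ultimately have "Poly_Mapping.lookup (Poly_Mapping.single n c * q) m = 0"
      using assms(2) unfolding homogeneous_def by (force simp: in_keys_iff)
    then show ?thesis using False by (simp add: lookup_single)
  qed
qed (simp_all add: lookup_add algebra_simps)

text \<open>The substitution sends monomials to monomials. By \<open>uniq\<close> no other quadratic
  monomial has the same image as the one given by \<open>a\<close> and \<open>b\<close>, so its
  coefficient cannot be cancelled.\<close>

lemma lookup_eq_0_if_monom_subst_zero:
  assumes "homogeneous 2 h" and zero: "poly_subst (\<lambda>b. Poly_Mapping.single (\<kappa> b) 1) h = 0"
    and uniq: "\<And>c d. \<kappa> c + \<kappa> d = \<kappa> a + \<kappa> b \<Longrightarrow> (c = a \<and> d = b) \<or> (c = b \<and> d = a)"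
  shows "Poly_Mapping.lookup (h :: ('x, 'k::field) mpoly)
    (Poly_Mapping.single a 1 + Poly_Mapping.single b 1) = 0"
proof -
  let ?N = "Poly_Mapping.single a 1 + Poly_Mapping.single b 1 :: 'x \<Rightarrow>\<^sub>0 nat"
  let ?T = "monom_subst (\<lambda>b. Poly_Mapping.single (\<kappa> b) 1) :: _ \<Rightarrow> (_, 'k) mpoly"
  have T: "Poly_Mapping.lookup (?T m) (\<kappa> a + \<kappa> b) = (1 when m = ?N)"
    if m: "m \<in> Poly_Mapping.keys h" for m
  proof -
    obtain c d where m: "m = Poly_Mapping.single c 1 + Poly_Mapping.single d 1"
      using mdeg_2E m assms(1) unfolding homogeneous_def by metis
    have T: "?T m = Poly_Mapping.single (\<kappa> c + \<kappa> d) 1"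
      unfolding m monom_subst_add by (simp add: mult_single)
    show ?thesis
    proof (cases "m = ?N")
      case True
      have "?T m = Poly_Mapping.single (\<kappa> a + \<kappa> b) 1"
        unfolding True monom_subst_add by (simp add: mult_single)
      then show ?thesis using True by simp
    next
      case False
      then have "\<kappa> c + \<kappa> d \<noteq> \<kappa> a + \<kappa> b"
        using uniq[of c d] m by (auto simp: add.commute)
      then show ?thesis using False T by (simp add: lookup_single when_def)
    qed
  qed
  have "0 = Poly_Mapping.lookup (poly_subst (\<lambda>b. Poly_Mapping.single (\<kappa> b) 1) h) (\<kappa> a + \<kappa> b)"
    by (simp add: zero)
  also have "\<dots> = (\<Sum>m\<in>Poly_Mapping.keys h. Poly_Mapping.lookup h m * (1 when m = ?N))"
    by (simp add: poly_subst_eq lookup_sum lookup_pconst_times T cong: sum.cong)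
  also have "\<dots> = Poly_Mapping.lookup h ?N"
    by (simp add: when_def sum.delta in_keys_iff if_distrib cong: if_cong)
  finally show ?thesis by simp
qed

section \<open>Linear syzygies\<close>

lemma lookup_nonzeroE:
  assumes "p \<noteq> 0"
  obtains m where "Poly_Mapping.lookup p m \<noteq> 0"
  using assms poly_mapping_eqI[of p 0] by auto

lemma poly_ring_mult:
  assumes "p \<in> carrier (poly_ring X)" "q \<in> carrier (poly_ring X)"
  shows "p * q \<in> carrier (poly_ring X)"
proof -
  have "Poly_Mapping.keys m \<subseteq> X" if m: "m \<in> Poly_Mapping.keys (p * q)" for m
  proof -
    obtain a b where "m = a + b" "a \<in> Poly_Mapping.keys p" "b \<in> Poly_Mapping.keys q"
      using keys_mult m by blast
    then show ?thesis
      using assms keys_add[of a b] unfolding poly_ring_def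
      by (simp only: mem_Collect_eq partial_object.simps) blast
  qed
  then show ?thesis by (simp add: poly_ring_def)
qed

lemma poly_ring_minus:
  assumes "p \<in> carrier (poly_ring X)" "q \<in> carrier (poly_ring X)"
  shows "p - q \<in> carrier (poly_ring X)"
proof -
  have "m \<in> Poly_Mapping.keys p \<or> m \<in> Poly_Mapping.keys q"
    if "m \<in> Poly_Mapping.keys (p - q)" for m
    using that by (auto simp: in_keys_iff lookup_minus)
  then show ?thesis using assms by (auto simp: poly_ring_def)
qed

lemma poly_ring_0: "0 \<in> carrier (poly_ring X)"
  by (simp add: poly_ring_def)

lemma poly_ring_1: "1 \<in> carrier (poly_ring X)"
  by (simp add: poly_ring_def)

lemma poly_ring_pvar: "x \<in> X \<Longrightarrow> pvar x \<in> carrier (poly_ring X)"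
  by (simp add: poly_ring_def pvar_def)

lemma poly_ring_prod_list:
  "set ps \<subseteq> carrier (poly_ring X) \<Longrightarrow> prod_list ps \<in> carrier (poly_ring X)"
  by (induction ps) (auto simp: poly_ring_1 poly_ring_mult)

text \<open>The vanishing Betti numbers place the basis of \<open>F 0\<close> in degree 2 and that
  of \<open>F 1\<close> in degree 3, so the entries of \<open>diff F 0\<close> are linear forms.
  Exactness at \<open>F 0\<close> writes every syzygy of the generators as a combination of the
  columns.\<close>

lemma property_N_generators_syzygies:
  fixes I :: "('x, 'k::field) mpoly set"
  assumes "property_N X 1 I"
  obtains n :: nat and u where
    "\<And>k. k < n \<Longrightarrow> u k \<in> I \<and> homogeneous 2 (u k)"
    "\<And>f. f \<in> I \<Longrightarrow> \<exists>v. (\<forall>k<n. v k \<in> carrier (poly_ring X)) \<and> f = (\<Sum>k<n. u k * v k)"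
    "\<And>s. (\<And>k. k < n \<Longrightarrow> s k \<in> carrier (poly_ring X)) \<Longrightarrow> (\<Sum>k<n. u k * s k) = 0 \<Longrightarrow>
      \<exists>(m::nat) D t. (\<forall>k<n. \<forall>l<m. homogeneous 1 (D k l)) \<and> (\<forall>l<m. (\<Sum>k<n. u k * D k l) = 0) \<and>
        (\<forall>k<n. s k = (\<Sum>l<m. D k l * t l))"
proof -
  obtain F where F: "minimal_graded_free_resolution X I F"
    and betti: "\<And>i d. i \<le> 1 \<Longrightarrow> d \<noteq> i + 2 \<Longrightarrow> graded_betti F i d = 0"
    using assms unfolding property_N_def by blast
  have deg: "gdeg F i k = i + 2" if "i \<le> 1" "k < rk F i" for i k
  proof (rule ccontr)
    assume "gdeg F i k \<noteq> i + 2"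
    then have "graded_betti F i (gdeg F i k) = 0" using betti that by blast
    then show False using that by (auto simp: graded_betti_def)
  qed
  let ?n = "rk F 0" and ?m = "rk F 1" and ?u = "\<lambda>k. aug F $ k" and ?D = "diff F 0"
  have res: "graded_free_resolution X I F"
    using F by (simp add: minimal_graded_free_resolution_def)
  then have maps: "graded_maps X F"
    and im: "(\<lambda>v. aug F \<bullet> v) ` free_mod X ?n = I"
    and ker: "{v \<in> free_mod X ?n. aug F \<bullet> v = 0} = (\<lambda>v. ?D *\<^sub>v v) ` free_mod X ?m"
    by (simp_all add: graded_free_resolution_def)
  have aug: "aug F \<in> carrier_vec ?n" and D: "?D \<in> carrier_mat ?n ?m"
    using maps by (auto simp: graded_maps_def free_mod_def)
  have aug_vec: "aug F \<bullet> v = (\<Sum>k<?n. ?u k * v $ k)" if "v \<in> carrier_vec ?n" for v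
    using that by (auto simp: scalar_prod_def atLeast0LessThan)
  have unit: "unit_vec m j \<in> free_mod X m" for m j
    by (auto simp: free_mod_def unit_vec_def poly_ring_0 poly_ring_1)
  show thesis
  proof (rule that[of ?n ?u])
    fix k assume k: "k < ?n"
    have "aug F \<bullet> unit_vec ?n k \<in> I" using im unit by blast
    then show "?u k \<in> I \<and> homogeneous 2 (?u k)"
      using k aug maps deg[of 0 k] by (auto simp: graded_maps_def numeral_2_eq_2)
  next
    fix f assume "f \<in> I"
    then obtain v where "v \<in> free_mod X ?n" "f = aug F \<bullet> v" using im by blast
    then show "\<exists>v. (\<forall>k<?n. v k \<in> carrier (poly_ring X)) \<and> f = (\<Sum>k<?n. ?u k * v k)"
      by (intro exI[of _ "\<lambda>k. v $ k"]) (auto simp: free_mod_def aug_vec)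
  next
    fix s assume s: "\<And>k. k < ?n \<Longrightarrow> s k \<in> carrier (poly_ring X)"
      and zero: "(\<Sum>k<?n. ?u k * s k) = 0"
    have "vec ?n s \<in> free_mod X ?n" using s by (simp add: free_mod_def)
    moreover have "aug F \<bullet> vec ?n s = 0" using zero by (simp add: aug_vec)
    ultimately obtain t where t: "t \<in> free_mod X ?m" "vec ?n s = ?D *\<^sub>v t"
      using ker by blast
    have hom: "homogeneous 1 (?D $$ (k, l))" if "k < ?n" "l < ?m" for k l
    proof -
      have "gdeg F 0 k + mdeg m = gdeg F 1 l" if "m \<in> Poly_Mapping.keys (?D $$ (k, l))" for m
        using maps \<open>k < ?n\<close> \<open>l < ?m\<close> that unfolding graded_maps_def by (metis One_nat_def)
      then show ?thesis using deg[of 0 k] deg[of 1 l] that by (auto simp: homogeneous_def)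
    qed
    \<comment> \<open>Unit vectors pick out the columns of the matrix, and exactness puts its image
      into the kernel of the augmentation.\<close>
    have col: "(\<Sum>k<?n. ?u k * ?D $$ (k, l)) = 0" if l: "l < ?m" for l
    proof -
      have "aug F \<bullet> (?D *\<^sub>v unit_vec ?m l) = 0" using ker unit by blast
      then show ?thesis using l D by (simp add: aug_vec scalar_prod_right_unit)
    qed
    have "s k = (\<Sum>l<?m. ?D $$ (k, l) * t $ l)" if "k < ?n" for k
    proof -
      have "s k = (?D *\<^sub>v t) $ k" using that t(2) by (metis index_vec)
      also have "\<dots> = (\<Sum>l<?m. ?D $$ (k, l) * t $ l)"
        using that D t(1) by (auto simp: scalar_prod_def atLeast0LessThan free_mod_def)
      finally show ?thesis .
    qed
    with hom col show "\<exists>(m::nat) D t. (\<forall>k<?n. \<forall>l<m. homogeneous 1 (D k l)) \<and>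
        (\<forall>l<m. (\<Sum>k<?n. ?u k * D k l) = 0) \<and> (\<forall>k<?n. s k = (\<Sum>l<m. D k l * t l))"
      by - (rule exI[of _ ?m], rule exI[of _ "\<lambda>k l. ?D $$ (k, l)"], rule exI[of _ "\<lambda>l. t $ l"], blast)
  qed
qed

text \<open>Every element is a combination of quadrics in \<open>I\<close>, so a homomorphism that
  kills these kills \<open>I\<close>. This serves the case of \<open>K4\<close>.\<close>

lemma poly_subst_eq_0_if_quadrics:
  assumes "property_N X 1 I" and "\<And>u. u \<in> I \<Longrightarrow> homogeneous 2 u \<Longrightarrow> poly_subst r u = 0"
    and "f \<in> I"
  shows "poly_subst r f = 0"
proof -
  from assms(1) obtain n u where
    u: "\<And>k. k < (n::nat) \<Longrightarrow> u k \<in> I \<and> homogeneous 2 (u k)" and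
    span: "\<And>f. f \<in> I \<Longrightarrow> \<exists>v. (\<forall>k<n. v k \<in> carrier (poly_ring X)) \<and> f = (\<Sum>k<n. u k * v k)"
    by (rule property_N_generators_syzygies) blast
  from span[OF assms(3)] obtain v where "f = (\<Sum>k<n. u k * v k)" by blast
  then show ?thesis using u assms(2) by (simp add: poly_subst_sum poly_subst_mult)
qed

text \<open>
  A quadric \<open>h k\<close> is a multiple of \<open>x y\<close> plus terms that involve neither variable, and multiplying
  the latter by a linear form cannot create the factor \<open>x y\<close>.
\<close>
lemma linear_syzygy_isolated_monomial:
  fixes h \<l> :: "nat \<Rightarrow> ('x, 'k::field) mpoly"
  assumes hom: "\<And>k. k < n \<Longrightarrow> homogeneous 2 (h k)" "\<And>k. k < n \<Longrightarrow> homogeneous 1 (\<l> k)"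
    and "x \<noteq> y"
    and x: "\<And>k z. k < n \<Longrightarrow> z \<noteq> y \<Longrightarrow>
      Poly_Mapping.lookup (h k) (Poly_Mapping.single z 1 + Poly_Mapping.single x 1) = 0"
    and y: "\<And>k z. k < n \<Longrightarrow> z \<noteq> x \<Longrightarrow>
      Poly_Mapping.lookup (h k) (Poly_Mapping.single z 1 + Poly_Mapping.single y 1) = 0"
    and zero: "(\<Sum>k<n. h k * \<l> k) = 0"
  shows "(\<Sum>k<n. pconst (Poly_Mapping.lookup (h k)
    (Poly_Mapping.single x 1 + Poly_Mapping.single y 1)) * \<l> k) = 0" (is "?L = 0")
proof (rule ccontr)
  let ?M = "Poly_Mapping.single x 1 + Poly_Mapping.single y 1 :: 'x \<Rightarrow>\<^sub>0 nat"
  define h' where "h' k = h k - Poly_Mapping.single ?M (Poly_Mapping.lookup (h k) ?M)" for k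
  have h'_keys: "Poly_Mapping.lookup p x = 0 \<and> Poly_Mapping.lookup p y = 0"
    if k: "k < n" and p: "p \<in> Poly_Mapping.keys (h' k)" for k p
  proof -
    have pM: "p \<noteq> ?M" using p by (auto simp: h'_def in_keys_iff lookup_minus)
    then have hp: "Poly_Mapping.lookup (h k) p \<noteq> 0"
      using p by (auto simp: h'_def in_keys_iff lookup_minus lookup_single_not_eq)
    then have "mdeg p = 2" using hom(1)[OF k] by (auto simp: homogeneous_def in_keys_iff)
    then obtain c d where cd: "p = Poly_Mapping.single c 1 + Poly_Mapping.single d 1"
      by (rule mdeg_2E)
    have "c \<noteq> x \<and> d \<noteq> x \<and> c \<noteq> y \<and> d \<noteq> y"
    proof (intro conjI notI)
      assume "c = x"
      then show False using y[OF k, of c] x[OF k, of d] hp pM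
        by (cases "d = y") (simp_all add: cd add.commute)
    next
      assume "d = x"
      then show False using x[OF k, of c] hp pM
        by (cases "c = y") (simp_all add: cd add.commute)
    next
      assume "c = y"
      then show False using y[OF k, of d] hp pM
        by (cases "d = x") (simp_all add: cd add.commute)
    next
      assume "d = y"
      then show False using y[OF k, of c] hp pM
        by (cases "c = x") (simp_all add: cd add.commute)
    qed
    then show ?thesis by (simp add: cd lookup_add lookup_single)
  qed
  assume "?L \<noteq> 0"
  \<comment> \<open>A monomial \<open>m\<close> of \<open>?L\<close> yields the monomial
    \<open>?M + m\<close> of the vanishing sum, because no product \<open>h' k * \<l> k\<close>
    reaches \<open>?M + m\<close>.\<close>
  then obtain m where m: "Poly_Mapping.lookup ?L m \<noteq> 0"
    by (rule lookup_nonzeroE)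
  have rest: "Poly_Mapping.lookup (h' k * \<l> k) (?M + m) = 0" if k: "k < n" for k
  proof (rule ccontr)
    assume "\<not> ?thesis"
    then have "?M + m \<in> Poly_Mapping.keys (h' k * \<l> k)" by (simp add: in_keys_iff)
    then obtain p q where pq: "p \<in> Poly_Mapping.keys (h' k)" "q \<in> Poly_Mapping.keys (\<l> k)"
      "?M + m = p + q"
      using keys_mult[of "h' k" "\<l> k"] by blast
    have "mdeg q = 1" using hom(2)[OF k] pq(2) by (simp add: homogeneous_def)
    then obtain w where w: "q = Poly_Mapping.single w 1" by (rule mdeg_1E)
    have "Poly_Mapping.lookup (?M + m) x = Poly_Mapping.lookup q x"
      "Poly_Mapping.lookup (?M + m) y = Poly_Mapping.lookup q y"
      using h'_keys[OF k pq(1)] unfolding pq(3) lookup_add by simp_all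
    then have "w = x" "w = y"
      by (auto simp: w lookup_add lookup_single when_def split: if_splits)
    then show False using \<open>x \<noteq> y\<close> by simp
  qed
  have split: "h k * \<l> k = Poly_Mapping.single ?M 1 * (pconst (Poly_Mapping.lookup (h k) ?M) * \<l> k)
      + h' k * \<l> k" for k
  proof -
    have "h k = Poly_Mapping.single ?M 1 * pconst (Poly_Mapping.lookup (h k) ?M) + h' k"
      by (simp add: h'_def pconst_def mult_single)
    then show ?thesis by (metis distrib_right mult.assoc)
  qed
  have "0 = (\<Sum>k<n. h k * \<l> k)" by (simp add: zero)
  also have "\<dots> = Poly_Mapping.single ?M 1 * ?L + (\<Sum>k<n. h' k * \<l> k)"
    by (subst split) (simp add: sum.distrib sum_distrib_left)
  finally have "0 = Poly_Mapping.lookup (Poly_Mapping.single ?M 1 * ?L + (\<Sum>k<n. h' k * \<l> k)) (?M + m)"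
    by (metis lookup_zero)
  also have "\<dots> = Poly_Mapping.lookup ?L m"
    by (simp only: lookup_add[of "Poly_Mapping.single ?M 1 * ?L"] lookup_single_times)
      (simp add: lookup_sum rest del: One_nat_def)
  finally show False using m by simp
qed

text \<open>
  The contradiction comes from the Koszul syzygy \<open>F\<^sub>2 v - F\<^sub>1 w\<close>, where \<open>F\<^sub>1 = \<Sum> u\<^sub>k v\<^sub>k\<close> and
  \<open>F\<^sub>2 = \<Sum> u\<^sub>k w\<^sub>k\<close>: it is not generated by linear syzygies.
\<close>
lemma isolated_monomial_not_property_N:
  fixes I :: "('x, 'k::field) mpoly set" and r :: "'x \<Rightarrow> ('y, 'k) mpoly"
  assumes N: "property_N X 1 I" and sub: "I \<subseteq> carrier (poly_ring X)"
    and r: "\<And>a. homogeneous 1 (r a)"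
    and "x \<noteq> y"
    and x: "\<And>u z. u \<in> I \<Longrightarrow> homogeneous 2 u \<Longrightarrow> z \<noteq> y \<Longrightarrow>
      Poly_Mapping.lookup (poly_subst r u) (Poly_Mapping.single z 1 + Poly_Mapping.single x 1) = 0"
    and y: "\<And>u z. u \<in> I \<Longrightarrow> homogeneous 2 u \<Longrightarrow> z \<noteq> x \<Longrightarrow>
      Poly_Mapping.lookup (poly_subst r u) (Poly_Mapping.single z 1 + Poly_Mapping.single y 1) = 0"
    and F: "F\<^sub>1 \<in> I" "F\<^sub>2 \<in> I" "homogeneous 2 F\<^sub>1" "homogeneous 2 F\<^sub>2"
    and F1: "Poly_Mapping.lookup (poly_subst r F\<^sub>1) (Poly_Mapping.single x 1 + Poly_Mapping.single y 1) \<noteq> 0"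
    and F2: "Poly_Mapping.lookup (poly_subst r F\<^sub>2) (Poly_Mapping.single x 1 + Poly_Mapping.single y 1) = 0"
      "poly_subst r F\<^sub>2 \<noteq> 0"
  shows False
proof -
  let ?M = "Poly_Mapping.single x 1 + Poly_Mapping.single y 1 :: 'y \<Rightarrow>\<^sub>0 nat"
  let ?\<rho> = "poly_subst r"
  from N obtain n u where
    u: "\<And>k. k < (n::nat) \<Longrightarrow> u k \<in> I \<and> homogeneous 2 (u k)" and
    span: "\<And>f. f \<in> I \<Longrightarrow> \<exists>v. (\<forall>k<n. v k \<in> carrier (poly_ring X)) \<and> f = (\<Sum>k<n. u k * v k)" and
    syz: "\<And>s. (\<And>k. k < n \<Longrightarrow> s k \<in> carrier (poly_ring X)) \<Longrightarrow> (\<Sum>k<n. u k * s k) = 0 \<Longrightarrow>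
      \<exists>(m::nat) D t. (\<forall>k<n. \<forall>l<m. homogeneous 1 (D k l)) \<and> (\<forall>l<m. (\<Sum>k<n. u k * D k l) = 0) \<and>
        (\<forall>k<n. s k = (\<Sum>l<(m::nat). D k l * t l))"
    by (rule property_N_generators_syzygies) blast
  obtain v where v: "\<forall>k<n. v k \<in> carrier (poly_ring X)" "F\<^sub>1 = (\<Sum>k<n. u k * v k)"
    using span[OF F(1)] by blast
  obtain w where w: "\<forall>k<n. w k \<in> carrier (poly_ring X)" "F\<^sub>2 = (\<Sum>k<n. u k * w k)"
    using span[OF F(2)] by blast
  define a where "a k = Poly_Mapping.lookup (?\<rho> (u k)) ?M" for k
  define s where "s k = F\<^sub>2 * v k - F\<^sub>1 * w k" for k
  have "s k \<in> carrier (poly_ring X)" if "k < n" for k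
    unfolding s_def using that v w F(1,2) sub by (auto intro!: poly_ring_minus poly_ring_mult)
  moreover have "(\<Sum>k<n. u k * s k) = 0"
  proof -
    have "(\<Sum>k<n. u k * s k) = F\<^sub>2 * (\<Sum>k<n. u k * v k) - F\<^sub>1 * (\<Sum>k<n. u k * w k)"
      by (simp add: s_def sum_distrib_left sum_subtractf algebra_simps)
    then show ?thesis by (simp flip: v(2) w(2))
  qed
  ultimately obtain m D t where
    D: "\<And>k l. k < n \<Longrightarrow> l < m \<Longrightarrow> homogeneous 1 (D k l)"
      "\<And>l. l < m \<Longrightarrow> (\<Sum>k<n. u k * D k l) = 0"
    and st: "\<And>k. k < n \<Longrightarrow> s k = (\<Sum>l<(m::nat). D k l * t l)"
    using syz[of s] by blast
  have L: "(\<Sum>k<n. pconst (a k) * ?\<rho> (D k l)) = 0" if l: "l < m" for l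
    unfolding a_def
  proof (rule linear_syzygy_isolated_monomial)
    have "?\<rho> (\<Sum>k<n. u k * D k l) = 0" using D(2)[OF l] by simp
    then show "(\<Sum>k<n. ?\<rho> (u k) * ?\<rho> (D k l)) = 0" by (simp add: poly_subst_sum poly_subst_mult)
  qed (use u D(1) l x y r \<open>x \<noteq> y\<close> in \<open>auto intro: homogeneous_poly_subst\<close>)
  \<comment> \<open>The weights \<open>a k\<close> annihilate the image of every linear syzygy,
    hence of every combination of them, in particular of \<open>s\<close>.\<close>
  have "(\<Sum>k<n. pconst (a k) * ?\<rho> (s k))
      = (\<Sum>k<n. \<Sum>l<m. pconst (a k) * ?\<rho> (D k l) * ?\<rho> (t l))"
    by (intro sum.cong) (auto simp: st poly_subst_sum poly_subst_mult sum_distrib_left mult.assoc)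
  also have "\<dots> = (\<Sum>l<m. (\<Sum>k<n. pconst (a k) * ?\<rho> (D k l)) * ?\<rho> (t l))"
    by (subst sum.swap) (simp add: sum_distrib_right)
  also have "\<dots> = 0" by (simp add: L)
  finally have zero: "(\<Sum>k<n. pconst (a k) * ?\<rho> (s k)) = 0" .
  obtain M' where M': "Poly_Mapping.lookup (?\<rho> F\<^sub>2) M' \<noteq> 0"
    using F2(2) by (rule lookup_nonzeroE)
  have hom: "homogeneous 2 (?\<rho> F\<^sub>1)" "homogeneous 2 (?\<rho> F\<^sub>2)"
    using F(3,4) r by (auto intro: homogeneous_poly_subst)
  then have mdeg: "mdeg M' = 2" using M' by (auto simp: homogeneous_def in_keys_iff)
  \<comment> \<open>The generators are quadrics, so only the constant terms of the cofactors
    contribute to the coefficient of \<open>?M\<close>.\<close>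
  have coeff: "Poly_Mapping.lookup (?\<rho> (\<Sum>k<n. u k * v k)) ?M
      = (\<Sum>k<n. a k * Poly_Mapping.lookup (?\<rho> (v k)) 0)" for v
  proof -
    have "Poly_Mapping.lookup (?\<rho> (v k) * ?\<rho> (u k)) ?M
        = Poly_Mapping.lookup (?\<rho> (v k)) 0 * Poly_Mapping.lookup (?\<rho> (u k)) ?M" if "k < n" for k
      by (rule lookup_times_homogeneous[of 2])
        (use u r that in \<open>auto intro: homogeneous_poly_subst simp: mdeg_add\<close>)
    then show ?thesis
      by (simp add: a_def poly_subst_sum poly_subst_mult lookup_sum mult.commute)
  qed
  have "pconst (a k) * ?\<rho> (s k)
      = pconst (a k) * ?\<rho> (v k) * ?\<rho> F\<^sub>2 - pconst (a k) * ?\<rho> (w k) * ?\<rho> F\<^sub>1" for k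
    by (simp add: s_def poly_subst_minus poly_subst_mult algebra_simps)
  \<comment> \<open>\<open>M'\<close> has degree 2, like the images of \<open>F\<^sub>1\<close> and
    \<open>F\<^sub>2\<close>, so again only the constant terms of \<open>v k\<close> and
    \<open>w k\<close> enter.\<close>
  then have "Poly_Mapping.lookup (pconst (a k) * ?\<rho> (s k)) M'
      = a k * Poly_Mapping.lookup (?\<rho> (v k)) 0 * Poly_Mapping.lookup (?\<rho> F\<^sub>2) M'
      - a k * Poly_Mapping.lookup (?\<rho> (w k)) 0 * Poly_Mapping.lookup (?\<rho> F\<^sub>1) M'" for k
    by (simp add: lookup_minus lookup_times_homogeneous[OF hom(1) mdeg]
        lookup_times_homogeneous[OF hom(2) mdeg] lookup_pconst_times)
  then have "Poly_Mapping.lookup (\<Sum>k<n. pconst (a k) * ?\<rho> (s k)) M'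
      = (\<Sum>k<n. a k * Poly_Mapping.lookup (?\<rho> (v k)) 0) * Poly_Mapping.lookup (?\<rho> F\<^sub>2) M'
      - (\<Sum>k<n. a k * Poly_Mapping.lookup (?\<rho> (w k)) 0) * Poly_Mapping.lookup (?\<rho> F\<^sub>1) M'"
    by (simp add: lookup_sum sum_subtractf sum_distrib_right)
  \<comment> \<open>By \<open>coeff\<close> the two sums are the coefficients of \<open>?M\<close>
    in the images of \<open>F\<^sub>1\<close> and \<open>F\<^sub>2\<close>. The second is 0, so a
    product of two nonzero scalars remains.\<close>
  also have "\<dots> = Poly_Mapping.lookup (?\<rho> F\<^sub>1) ?M * Poly_Mapping.lookup (?\<rho> F\<^sub>2) M'
      - Poly_Mapping.lookup (?\<rho> F\<^sub>2) ?M * Poly_Mapping.lookup (?\<rho> F\<^sub>1) M'"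
    by (simp only: coeff[of v, folded v(2)] coeff[of w, folded w(2)])
  finally show False using zero F1 F2(1) M' by simp
qed

lemma single_add_single_eq_iff:
  "Poly_Mapping.single a (1::nat) + Poly_Mapping.single b 1 = Poly_Mapping.single c 1 + Poly_Mapping.single d 1
    \<longleftrightarrow> (a = c \<and> b = d) \<or> (a = d \<and> b = c)" (is "?l = ?r \<longleftrightarrow> _")
proof
  assume eq: "?l = ?r"
  have "Poly_Mapping.lookup ?l z = Poly_Mapping.lookup ?r z" for z by (simp only: eq)
  from this[of a] this[of b] this[of c] this[of d] show "(a = c \<and> b = d) \<or> (a = d \<and> b = c)"
    by (auto simp: lookup_add lookup_single when_def split: if_splits)
qed (auto simp: add.commute)

lemma lookup_pvar_mult:
  "Poly_Mapping.lookup (pvar a * pvar b :: ('x, 'k::field) mpoly)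
      (Poly_Mapping.single c 1 + Poly_Mapping.single d 1)
    = of_bool ((a = c \<and> b = d) \<or> (a = d \<and> b = c))"
  unfolding pvar_def mult_single lookup_single single_add_single_eq_iff by (simp add: when_def)

section \<open>Retracts of graphs\<close>

lemma simple_graph_edgeD:
  assumes "simple_graph G" "{x, y} \<in> edges G"
  shows "x \<in> verts G" "y \<in> verts G" "x \<noteq> y"
proof -
  obtain u v where "u \<in> verts G" "v \<in> verts G" "u \<noteq> v" "{x, y} = {u, v}"
    using assms unfolding simple_graph_def by blast
  then show "x \<in> verts G" "y \<in> verts G" "x \<noteq> y"
    by (auto simp: doubleton_eq_iff)
qed

lemma simple_graph_edgeE:
  assumes "simple_graph G" "e \<in> edges G"
  obtains x y where "e = {x, y}" "x \<in> verts G" "y \<in> verts G" "x \<noteq> y"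
  using assms unfolding simple_graph_def by blast

lemma simple_graph_finite_edges:
  assumes "simple_graph G"
  shows "finite (edges G)"
proof (rule finite_subset)
  show "edges G \<subseteq> Pow (verts G)" using assms unfolding simple_graph_def by fastforce
  show "finite (Pow (verts G))" using assms unfolding simple_graph_def by simp
qed

text \<open>\<open>\<sigma>\<close> stands for the indicator function of one side of a partition of
  the vertices.\<close>

definition uncut_on_fibres :: "'v graph \<Rightarrow> ('v \<Rightarrow> 'w) \<Rightarrow> ('v \<Rightarrow> bool) \<Rightarrow> bool" where
  "uncut_on_fibres G p \<sigma> \<longleftrightarrow> (\<forall>x y. {x, y} \<in> edges G \<longrightarrow> p x = p y \<longrightarrow> \<sigma> x = \<sigma> y)"

text \<open>
  A vertex map \<open>p\<close> with section \<open>j\<close> through which partitions of \<open>H\<close> pull back to \<open>G\<close>, and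
  partitions of \<open>G\<close> that cut no edge collapsed by \<open>p\<close> restrict to \<open>H\<close>. The last condition says
  that the restriction is also compatible with the cut ideals: every edge of \<open>H\<close> is lifted to an edge
  of \<open>G\<close> that is cut exactly when the former is cut by the restriction.
\<close>
definition cut_retract :: "'v graph \<Rightarrow> 'w graph \<Rightarrow> ('v \<Rightarrow> 'w) \<Rightarrow> ('w \<Rightarrow> 'v) \<Rightarrow> bool" where
  "cut_retract G H p j \<longleftrightarrow>
     p ` verts G \<subseteq> verts H \<and> j ` verts H \<subseteq> verts G \<and> (\<forall>a\<in>verts H. p (j a) = a) \<and>
     (\<forall>x y. {x, y} \<in> edges G \<longrightarrow> p x \<noteq> p y \<longrightarrow> {p x, p y} \<in> edges H) \<and>
     (\<forall>a b. {a, b} \<in> edges H \<longrightarrow> (\<exists>x y. {x, y} \<in> edges G \<and>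
        (\<forall>\<sigma>. uncut_on_fibres G p \<sigma> \<longrightarrow> \<sigma> x = \<sigma> (j a) \<and> \<sigma> y = \<sigma> (j b))))"

lemma cut_retract_refl: "cut_retract G G id id"
  unfolding cut_retract_def by auto

text \<open>Lifts of edges compose. The point is that a \<open>\<sigma>\<close> admissible for the
  composite map gives an admissible \<open>\<sigma> \<circ> j\<^sub>1\<close> for
  \<open>p\<^sub>2\<close>: an edge collapsed by \<open>p\<^sub>2\<close> lifts to an edge collapsed
  by the composite.\<close>

lemma cut_retract_trans:
  assumes 1: "cut_retract G\<^sub>1 G\<^sub>2 p\<^sub>1 j\<^sub>1" and 2: "cut_retract G\<^sub>2 G\<^sub>3 p\<^sub>2 j\<^sub>2"
    and "simple_graph G\<^sub>2"
  shows "cut_retract G\<^sub>1 G\<^sub>3 (p\<^sub>2 \<circ> p\<^sub>1) (j\<^sub>1 \<circ> j\<^sub>2)"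
proof -
  have "\<exists>x y. {x, y} \<in> edges G\<^sub>1 \<and> (\<forall>\<sigma>. uncut_on_fibres G\<^sub>1 (p\<^sub>2 \<circ> p\<^sub>1) \<sigma> \<longrightarrow>
      \<sigma> x = \<sigma> (j\<^sub>1 (j\<^sub>2 a)) \<and> \<sigma> y = \<sigma> (j\<^sub>1 (j\<^sub>2 b)))" if ab: "{a, b} \<in> edges G\<^sub>3" for a b
  proof -
    obtain c d where cd: "{c, d} \<in> edges G\<^sub>2"
      "\<And>\<sigma>. uncut_on_fibres G\<^sub>2 p\<^sub>2 \<sigma> \<Longrightarrow> \<sigma> c = \<sigma> (j\<^sub>2 a) \<and> \<sigma> d = \<sigma> (j\<^sub>2 b)"
      using 2 ab unfolding cut_retract_def by blast
    obtain x y where xy: "{x, y} \<in> edges G\<^sub>1"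
      "\<And>\<sigma>. uncut_on_fibres G\<^sub>1 p\<^sub>1 \<sigma> \<Longrightarrow> \<sigma> x = \<sigma> (j\<^sub>1 c) \<and> \<sigma> y = \<sigma> (j\<^sub>1 d)"
      using 1 cd(1) unfolding cut_retract_def by blast
    have "\<sigma> x = \<sigma> (j\<^sub>1 (j\<^sub>2 a)) \<and> \<sigma> y = \<sigma> (j\<^sub>1 (j\<^sub>2 b))"
      if \<sigma>: "uncut_on_fibres G\<^sub>1 (p\<^sub>2 \<circ> p\<^sub>1) \<sigma>" for \<sigma>
    proof -
      have \<sigma>1: "uncut_on_fibres G\<^sub>1 p\<^sub>1 \<sigma>"
        using \<sigma> unfolding uncut_on_fibres_def by simp
      have "uncut_on_fibres G\<^sub>2 p\<^sub>2 (\<lambda>z. \<sigma> (j\<^sub>1 z))"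
        unfolding uncut_on_fibres_def
      proof (intro allI impI)
        fix s t assume st: "{s, t} \<in> edges G\<^sub>2" "p\<^sub>2 s = p\<^sub>2 t"
        obtain x' y' where xy': "{x', y'} \<in> edges G\<^sub>1"
          "\<And>\<sigma>. uncut_on_fibres G\<^sub>1 p\<^sub>1 \<sigma> \<Longrightarrow> \<sigma> x' = \<sigma> (j\<^sub>1 s) \<and> \<sigma> y' = \<sigma> (j\<^sub>1 t)"
          using 1 st(1) unfolding cut_retract_def by blast
        \<comment> \<open>Testing the lift with indicators of fibres of \<open>p\<^sub>1\<close>
          shows that its endpoints lie over \<open>s\<close> and \<open>t\<close>.\<close>
        have "uncut_on_fibres G\<^sub>1 p\<^sub>1 (\<lambda>z. p\<^sub>1 z = c)" for c
          by (simp add: uncut_on_fibres_def)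
        then have "(p\<^sub>1 x' = c) = (p\<^sub>1 (j\<^sub>1 s) = c)" "(p\<^sub>1 y' = c) = (p\<^sub>1 (j\<^sub>1 t) = c)" for c
          using xy'(2) by blast+
        then have "p\<^sub>1 x' = s" "p\<^sub>1 y' = t"
          using simple_graph_edgeD[OF \<open>simple_graph G\<^sub>2\<close> st(1)] 1 unfolding cut_retract_def by auto
        then have "\<sigma> x' = \<sigma> y'"
          using \<sigma> xy'(1) st(2) unfolding uncut_on_fibres_def by simp
        then show "\<sigma> (j\<^sub>1 s) = \<sigma> (j\<^sub>1 t)" using xy'(2)[OF \<sigma>1] by simp
      qed
      then show ?thesis using cd(2) xy(2)[OF \<sigma>1] by blast
    qed
    then show ?thesis using xy(1) by blast
  qed
  moreover have "{p\<^sub>2 (p\<^sub>1 x), p\<^sub>2 (p\<^sub>1 y)} \<in> edges G\<^sub>3"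
    if "{x, y} \<in> edges G\<^sub>1" "p\<^sub>2 (p\<^sub>1 x) \<noteq> p\<^sub>2 (p\<^sub>1 y)" for x y
    using 1 2 that unfolding cut_retract_def by metis
  moreover have "(\<lambda>x. p\<^sub>2 (p\<^sub>1 x)) ` verts G\<^sub>1 \<subseteq> verts G\<^sub>3" "(\<lambda>x. j\<^sub>1 (j\<^sub>2 x)) ` verts G\<^sub>3 \<subseteq> verts G\<^sub>1"
    "\<forall>a\<in>verts G\<^sub>3. p\<^sub>2 (p\<^sub>1 (j\<^sub>1 (j\<^sub>2 a))) = a"
    using 1 2 unfolding cut_retract_def by (auto simp: image_subset_iff)
  ultimately show ?thesis unfolding cut_retract_def by (simp add: comp_def)
qed

text \<open>A new edge from \<open>w\<close> to \<open>z\<close> lifts to an edge from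
  \<open>z\<close> to \<open>u\<close> or \<open>v\<close>. Either choice works, since
  \<open>{u, v}\<close> is collapsed and so \<open>\<sigma> u = \<sigma> v\<close>.\<close>

lemma cut_retract_contract_edge:
  assumes G: "simple_graph G" and uv: "u \<noteq> v" "{u, v} \<in> edges G" and w: "w \<notin> verts G - {u, v}"
  defines "p \<equiv> \<lambda>x. if x = u \<or> x = v then w else x" and "j \<equiv> \<lambda>x. if x = w then u else x"
  shows "cut_retract G (contract_edge G u v w) p j"
  unfolding cut_retract_def
proof (intro conjI allI impI)
  note V = simple_graph_edgeD[OF G]
  have u: "u \<in> verts G" using V uv by blast
  show "p ` verts G \<subseteq> verts (contract_edge G u v w)"
    by (auto simp: p_def contract_edge_def)
  show "j ` verts (contract_edge G u v w) \<subseteq> verts G"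
    using u by (auto simp: j_def contract_edge_def)
  show "\<forall>a\<in>verts (contract_edge G u v w). p (j a) = a"
    by (auto simp: p_def j_def contract_edge_def)
  show "{p x, p y} \<in> edges (contract_edge G u v w)" if xy: "{x, y} \<in> edges G" "p x \<noteq> p y" for x y
  proof -
    have "x \<notin> {u, v} \<or> y \<notin> {u, v}" using xy by (auto simp: p_def)
    then consider "x \<notin> {u, v}" "y \<notin> {u, v}" | "x \<in> {u, v}" "y \<notin> {u, v}" | "x \<notin> {u, v}" "y \<in> {u, v}"
      by blast
    then show ?thesis
    proof cases
      case 1
      then show ?thesis using xy by (auto simp: p_def contract_edge_def)
    next
      case 2
      then show ?thesis using xy(1) V[OF xy(1)]
        by (auto simp: p_def contract_edge_def insert_commute)
    next
      case 3
      then have "{p x, p y} = {w, x}" by (auto simp: p_def)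
      then show ?thesis using 3 xy(1) V[OF xy(1)]
        by (auto simp: contract_edge_def insert_commute)
    qed
  qed
  fix a b assume ab: "{a, b} \<in> edges (contract_edge G u v w)"
  show "\<exists>x y. {x, y} \<in> edges G \<and>
      (\<forall>\<sigma>. uncut_on_fibres G p \<sigma> \<longrightarrow> \<sigma> x = \<sigma> (j a) \<and> \<sigma> y = \<sigma> (j b))"
  proof (cases "{a, b} \<in> edges G \<and> {a, b} \<inter> {u, v} = {}")
    case True
    then have "a \<noteq> w" "b \<noteq> w" using V[of a b] w by auto
    then show ?thesis using True by (auto simp: j_def)
  next
    case False
    then obtain z where z: "{a, b} = {w, z}" "z \<in> verts G - {u, v}"
      "{z, u} \<in> edges G \<or> {z, v} \<in> edges G"
      using ab by (auto simp: contract_edge_def)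
    obtain t where t: "{z, t} \<in> edges G" "t = u \<or> t = v" using z(3) by blast
    have "\<sigma> t = \<sigma> u" if "uncut_on_fibres G p \<sigma>" for \<sigma>
      using that uv(2) t(2) by (auto simp: uncut_on_fibres_def p_def)
    moreover have "j w = u" "j z = z" "z \<noteq> w" using z(2) w by (auto simp: j_def)
    moreover have "a = w \<and> b = z \<or> a = z \<and> b = w" using z(1) by (auto simp: doubleton_eq_iff)
    moreover have "{t, z} \<in> edges G" using t(1) by (simp add: insert_commute)
    ultimately show ?thesis using t(1) by metis
  qed
qed

lemma simple_graph_contract_edge:
  assumes G: "simple_graph G" and w: "w \<notin> verts G - {u, v}"
  shows "simple_graph (contract_edge G u v w)"
  unfolding simple_graph_def
proof (intro conjI ballI)
  show "finite (verts (contract_edge G u v w))" "verts (contract_edge G u v w) \<noteq> {}"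
    using G by (auto simp: simple_graph_def contract_edge_def)
  fix e assume "e \<in> edges (contract_edge G u v w)"
  then consider "e \<in> edges G" "e \<inter> {u, v} = {}" | z where "z \<in> verts G - {u, v}" "e = {w, z}"
    by (auto simp: contract_edge_def)
  then show "\<exists>a\<in>verts (contract_edge G u v w). \<exists>b\<in>verts (contract_edge G u v w). a \<noteq> b \<and> e = {a, b}"
  proof cases
    case 1
    obtain a b where "e = {a, b}" "a \<in> verts G" "b \<in> verts G" "a \<noteq> b"
      by (rule simple_graph_edgeE[OF G 1(1)])
    then show ?thesis using 1(2) by (auto simp: contract_edge_def)
  next
    case 2
    then show ?thesis using w by (auto simp: contract_edge_def)
  qed
qed

text \<open>The retraction fixes \<open>W\<close> and sends all of \<open>W'\<close> to
  \<open>v\<close>. An edge from \<open>x\<close> in \<open>W\<close> to \<open>W'\<close> is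
  collapsed or becomes the edge from \<open>x\<close> to \<open>v\<close>, because \<open>x\<close>
  lies in the closed neighborhood of \<open>v\<close>. Edges of \<open>H\<close> lift to
  themselves.\<close>

lemma neighborhood_minor_cut_retract:
  assumes G: "simple_graph G" and "neighborhood_minor G H"
  shows "simple_graph H \<and> (\<exists>p j. cut_retract G H p j)"
proof -
  obtain W W' v where W: "verts G = W \<union> W'" "W \<inter> W' = {}" "W \<noteq> {}"
    and H: "H = induced_subgraph G W" and v: "v \<in> W" "W \<inter> nbrs_of G W' \<subseteq> closed_nbrs H v"
    using assms(2) unfolding neighborhood_minor_def by blast
  have HV: "verts H = W" "edges H = {e \<in> edges G. e \<subseteq> W}"
    by (simp_all add: H induced_subgraph_def)
  have "simple_graph H"
    unfolding simple_graph_def HV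
  proof (intro conjI ballI)
    show "finite W" using G W by (auto simp: simple_graph_def)
    show "W \<noteq> {}" by (fact W(3))
    fix e assume e: "e \<in> {e \<in> edges G. e \<subseteq> W}"
    then obtain a b where "e = {a, b}" "a \<noteq> b" using simple_graph_edgeE[OF G, of e] by blast
    then show "\<exists>a\<in>W. \<exists>b\<in>W. a \<noteq> b \<and> e = {a, b}" using e by blast
  qed
  moreover define p where "p x = (if x \<in> W then x else v)" for x
  have out: "x = v \<or> {x, v} \<in> edges H" if "{x, y} \<in> edges G" "x \<in> W" "y \<notin> W" for x y
  proof -
    have "y \<in> W'" using simple_graph_edgeD[OF G that(1)] W that by blast
    moreover have "x \<in> nbrs G y" using that W by (auto simp: nbrs_def)
    ultimately have "x \<in> closed_nbrs H v" using v that unfolding nbrs_of_def by blast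
    then show ?thesis by (auto simp: closed_nbrs_def nbrs_def)
  qed
  have "{p x, p y} \<in> edges H" if xy: "{x, y} \<in> edges G" "p x \<noteq> p y" for x y
  proof -
    have "x \<in> W \<or> y \<in> W" using xy(2) unfolding p_def by presburger
    then consider "x \<in> W" "y \<in> W" | "x \<in> W" "y \<notin> W" | "x \<notin> W" "y \<in> W"
      by blast
    then show ?thesis
    proof cases
      case 1
      then show ?thesis using xy by (simp add: p_def HV)
    next
      case 2
      then show ?thesis using xy out[of x y] by (auto simp: p_def)
    next
      case 3
      then show ?thesis using xy out[of y x] by (auto simp: p_def insert_commute)
    qed
  qed
  then have "cut_retract G H p id"
    unfolding cut_retract_def using W(1) v(1) by (auto simp: HV p_def)
  ultimately show ?thesis by blast
qed

lemma combinatorial_retract_cut_retract: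
  assumes "combinatorial_retract G G'" and G: "simple_graph G"
  shows "simple_graph G' \<and> (\<exists>p j. cut_retract G G' p j)"
  using assms(1) unfolding combinatorial_retract_def
proof (induction rule: rtranclp_induct)
  case base
  then show ?case using G cut_retract_refl by blast
next
  case (step H H')
  then have H: "simple_graph H" by simp
  from step(2) have "simple_graph H' \<and> (\<exists>p j. cut_retract H H' p j)"
  proof
    assume "edge_contraction H H'"
    then show ?thesis unfolding edge_contraction_def
      using simple_graph_contract_edge[OF H] cut_retract_contract_edge[OF H] by blast
  qed (rule neighborhood_minor_cut_retract[OF H])
  then show ?case using step.IH cut_retract_trans[OF _ _ H] by blast
qed

lemma graph_iso_cut_retract:
  assumes "graph_iso G H" and G: "simple_graph G"
  shows "\<exists>p j. cut_retract G H p j"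
proof -
  obtain f where f: "bij_betw f (verts G) (verts H)" and E: "edges H = (\<lambda>e. f ` e) ` edges G"
    using assms(1) unfolding graph_iso_def by blast
  let ?j = "inv_into (verts G) f"
  have j: "?j (f x) = x" if "x \<in> verts G" for x
    using f that by (simp add: bij_betw_def inv_into_f_f)
  have "cut_retract G H f ?j"
    unfolding cut_retract_def
  proof (intro conjI allI impI)
    show "f ` verts G \<subseteq> verts H" "?j ` verts H \<subseteq> verts G" "\<forall>a\<in>verts H. f (?j a) = a"
      using f by (auto simp: bij_betw_def inv_into_into f_inv_into_f)
    show "{f x, f y} \<in> edges H" if "{x, y} \<in> edges G" for x y
      using imageI[OF that, of "\<lambda>e. f ` e"] by (simp add: E)
    fix a b assume "{a, b} \<in> edges H"
    then obtain e where e: "e \<in> edges G" "{a, b} = f ` e" unfolding E by blast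
    obtain x y where xy: "e = {x, y}" "x \<in> verts G" "y \<in> verts G"
      using simple_graph_edgeE[OF G e(1)] by blast
    have "{x, y} \<in> edges G" "{y, x} \<in> edges G" using e(1) xy(1) by (simp_all add: insert_commute)
    moreover have "a = f x \<and> b = f y \<or> a = f y \<and> b = f x"
      using e(2) by (auto simp: xy(1) doubleton_eq_iff)
    ultimately show "\<exists>x y. {x, y} \<in> edges G \<and>
        (\<forall>\<sigma>. uncut_on_fibres G f \<sigma> \<longrightarrow> \<sigma> x = \<sigma> (?j a) \<and> \<sigma> y = \<sigma> (?j b))"
      using j xy by metis
  qed
  then show ?thesis by blast
qed

section \<open>Cut ideals of retracts with four vertices\<close>

lemma K4_minus_edge_eq:
  "K4_minus_edge = \<lparr>verts = {0, 1, 2, 3}, edges = {{0, 2}, {0, 3}, {1, 2}, {1, 3}, {2, 3}}\<rparr>"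
  by (auto simp: K4_minus_edge_def K4_def doubleton_eq_iff)

section \<open>Cuts in terms of separated vertices\<close>

lemma vertex_partitionE:
  assumes "D \<in> vertex_partitions G"
  obtains A B where "D = {A, B}" "A \<union> B = verts G" "A \<inter> B = {}"
  using assms unfolding vertex_partitions_def by blast

text \<open>Phrased by common membership, so that neither part of the unordered partition has to be
  singled out.\<close>

definition separates :: "'v set set \<Rightarrow> 'v \<Rightarrow> 'v \<Rightarrow> bool" where
  "separates D x y \<longleftrightarrow> (\<forall>A\<in>D. \<not> (x \<in> A \<and> y \<in> A))"

lemma separates_iff:
  assumes "A \<union> B = V" "A \<inter> B = {}" "x \<in> V" "y \<in> V"
  shows "separates {A, B} x y \<longleftrightarrow> (x \<in> A) \<noteq> (y \<in> A)"
  using assms unfolding separates_def by blast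

lemma Cut_iff_separates:
  assumes "simple_graph G" "D \<in> vertex_partitions G" and e: "{x, y} \<in> edges G"
  shows "{x, y} \<in> Cut G D \<longleftrightarrow> separates D x y"
proof -
  obtain A B where AB: "D = {A, B}" "A \<union> B = verts G" "A \<inter> B = {}"
    using assms(2) by (rule vertex_partitionE)
  have xy: "x \<in> verts G" "y \<in> verts G" using simple_graph_edgeD[OF assms(1) e] by auto
  have "{x, y} \<in> Cut G D \<longleftrightarrow> (x \<in> A \<and> y \<in> B) \<or> (y \<in> A \<and> x \<in> B)"
    using e unfolding Cut_def AB(1) by (auto simp: doubleton_eq_iff)
  also have "\<dots> \<longleftrightarrow> (x \<in> A) \<noteq> (y \<in> A)" using AB(2,3) xy by blast
  finally show ?thesis using separates_iff[OF AB(2,3) xy] AB(1) by simp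
qed

text \<open>
  A partition of \<open>{0, 1, 2, 3}\<close> is encoded by which of \<open>1, 2, 3\<close> it separates from \<open>0\<close>.
\<close>
definition side :: "bool \<times> bool \<times> bool \<Rightarrow> nat \<Rightarrow> bool" where
  "side = (\<lambda>(b\<^sub>1, b\<^sub>2, b\<^sub>3) i. (i = 1 \<and> b\<^sub>1) \<or> (i = 2 \<and> b\<^sub>2) \<or> (i = 3 \<and> b\<^sub>3))"

lemma side_simps [simp]:
  "side b 0 = False" "side (b\<^sub>1, b\<^sub>2, b\<^sub>3) 1 = b\<^sub>1" "side (b\<^sub>1, b\<^sub>2, b\<^sub>3) (Suc 0) = b\<^sub>1"
  "side (b\<^sub>1, b\<^sub>2, b\<^sub>3) 2 = b\<^sub>2" "side (b\<^sub>1, b\<^sub>2, b\<^sub>3) 3 = b\<^sub>3"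
  by (auto simp: side_def split: prod.splits)

definition cuts :: "bool \<times> bool \<times> bool \<Rightarrow> nat set \<Rightarrow> bool" where
  "cuts b e \<longleftrightarrow> (\<exists>a c. e = {a, c} \<and> side b a \<noteq> side b c)"

lemma cuts_edge: "cuts b {a, c} \<longleftrightarrow> side b a \<noteq> side b c"
  by (auto simp: cuts_def doubleton_eq_iff)

abbreviation cut_monomial :: "'v graph \<Rightarrow> 'v set set \<Rightarrow> ('v set st_var, 'k::field) mpoly" where
  "cut_monomial G D \<equiv>
     (\<Prod>e\<in>Cut G D. pvar (S_var e)) * (\<Prod>e\<in>edges G - Cut G D. pvar (T_var e))"

text \<open>The binomial \<open>q\<^sub>c q\<^sub>d - q\<^sub>a q\<^sub>b\<close> lies in the cut ideal of \<open>H\<close>.\<close>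
definition same_cuts :: "nat graph \<Rightarrow> bool \<times> bool \<times> bool \<Rightarrow> bool \<times> bool \<times> bool \<Rightarrow>
    bool \<times> bool \<times> bool \<Rightarrow> bool \<times> bool \<times> bool \<Rightarrow> bool" where
  "same_cuts H c d a b \<longleftrightarrow> (\<forall>e\<in>edges H. {#cuts c e, cuts d e#} = {#cuts a e, cuts b e#})"

text \<open>The sums are exponents of one edge variable in products of two cut monomials; this links
  them to \<open>same_cuts\<close>.\<close>

lemma of_bool_add_eq_iff:
  "of_bool P + of_bool Q = (of_bool R + of_bool S :: nat) \<longleftrightarrow> {#P, Q#} = {#R, S#}"
  by (cases P; cases Q; cases R; cases S) (simp_all add: add_eq_conv_diff)

text \<open>Turns \<open>same_cuts\<close> for a concrete graph into a propositional formula in the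
  bits of the four cuts, which \<open>argo\<close> can decide.\<close>

lemma mset_bool_pair_eq_iff:
  "{#P, Q#} = {#R, S#} \<longleftrightarrow> (P \<and> Q \<longleftrightarrow> R \<and> S) \<and> (P \<or> Q \<longleftrightarrow> R \<or> S)"
  by (cases P; cases Q; cases R; cases S) (simp_all add: add_eq_conv_diff)

lemma prod_list_prod: "(\<Prod>b\<leftarrow>bs. \<Prod>e\<in>E. f e b) = (\<Prod>e\<in>E. \<Prod>b\<leftarrow>bs. f e b)"
  for f :: "'e \<Rightarrow> 'b \<Rightarrow> 'a::comm_monoid_mult"
  by (induction bs) (simp_all add: prod.distrib)

locale four_vertex_retract =
  fixes G :: "'v graph" and H :: "nat graph" and p :: "'v \<Rightarrow> nat" and j :: "nat \<Rightarrow> 'v"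
  assumes G: "simple_graph G" and H: "simple_graph H" and verts_H: "verts H = {0, 1, 2, 3}"
    and retract: "cut_retract G H p j"
begin

lemmas finite_edges [simp] = simple_graph_finite_edges[OF G] simple_graph_finite_edges[OF H]

lemma finite_Cut [simp]: "finite (Cut G D)"
  by (rule finite_subset[of _ "edges G"]) (auto simp: Cut_def)

lemma j_verts: "i \<in> {0, 1, 2, 3} \<Longrightarrow> j i \<in> verts G"
  and p_j: "i \<in> {0, 1, 2, 3} \<Longrightarrow> p (j i) = i"
  using retract unfolding cut_retract_def verts_H image_subset_iff by metis+

lemma edge_H_verts: "{a, c} \<in> edges H \<Longrightarrow> a \<in> {0, 1, 2, 3} \<and> c \<in> {0, 1, 2, 3}"
  using simple_graph_edgeD[OF H] verts_H by blast

section \<open>Pullback and restriction of partitions\<close>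

definition pull :: "bool \<times> bool \<times> bool \<Rightarrow> 'v set set" where
  "pull b = {{x \<in> verts G. side b (p x)}, {x \<in> verts G. \<not> side b (p x)}}"

text \<open>The restriction of \<open>D\<close> along \<open>j\<close>, in the encoding of
  \<open>side\<close>, with \<open>0\<close> as base vertex.\<close>

definition push :: "'v set set \<Rightarrow> bool \<times> bool \<times> bool" where
  "push D = (separates D (j 0) (j 1), separates D (j 0) (j 2), separates D (j 0) (j 3))"

definition pushable :: "'v set set \<Rightarrow> bool" where
  "pushable D \<longleftrightarrow> (\<forall>x y. {x, y} \<in> Cut G D \<longrightarrow> p x \<noteq> p y)"

lemma pull_partition: "pull b \<in> vertex_partitions G"
  unfolding pull_def vertex_partitions_def by blast

lemma separates_pull:
  assumes "x \<in> verts G" "y \<in> verts G"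
  shows "separates (pull b) x y \<longleftrightarrow> side b (p x) \<noteq> side b (p y)"
proof -
  have "separates (pull b) x y \<longleftrightarrow> (x \<in> {x \<in> verts G. side b (p x)}) \<noteq> (y \<in> {x \<in> verts G. side b (p x)})"
    unfolding pull_def by (rule separates_iff[of _ _ "verts G"]) (use assms in auto)
  then show ?thesis using assms by simp
qed

lemma Cut_pull:
  assumes "{x, y} \<in> edges G"
  shows "{x, y} \<in> Cut G (pull b) \<longleftrightarrow> side b (p x) \<noteq> side b (p y)"
  using Cut_iff_separates[OF G pull_partition assms] separates_pull simple_graph_edgeD[OF G assms]
  by blast

lemma pushable_pull: "pushable (pull b)"
  unfolding pushable_def
proof (intro allI impI)
  fix x y assume e: "{x, y} \<in> Cut G (pull b)"
  then have "{x, y} \<in> edges G" by (simp add: Cut_def)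
  then show "p x \<noteq> p y" using e Cut_pull by metis
qed

lemma push_pull: "push (pull b) = b"
  by (cases b) (simp add: push_def separates_pull j_verts p_j)

text \<open>Each bit compares the position of a vertex with that of \<open>j 0\<close>. Comparing
  two bits cancels \<open>j 0\<close>.\<close>

lemma side_push:
  assumes "D \<in> vertex_partitions G" "a \<in> {0, 1, 2, 3}" "c \<in> {0, 1, 2, 3}"
  shows "side (push D) a \<noteq> side (push D) c \<longleftrightarrow> separates D (j a) (j c)"
proof -
  obtain A B where AB: "D = {A, B}" "A \<union> B = verts G" "A \<inter> B = {}"
    using assms(1) by (rule vertex_partitionE)
  have sep: "separates D (j i) (j k) \<longleftrightarrow> (j i \<in> A) \<noteq> (j k \<in> A)"
    if "i \<in> {0, 1, 2, 3}" "k \<in> {0, 1, 2, 3}" for i k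
    unfolding AB(1) by (rule separates_iff[OF AB(2,3)]) (use that j_verts in blast)+
  have "side (push D) i \<longleftrightarrow> (j 0 \<in> A) \<noteq> (j i \<in> A)" if "i \<in> {0, 1, 2, 3}" for i
    using that sep[of 0 1] sep[of 0 2] sep[of 0 3] by (auto simp: push_def)
  then show ?thesis using sep[OF assms(2,3)] assms(2,3) by blast
qed

lemma uncut_on_fibres_pushable:
  assumes "pushable D" and AB: "D = {A, B}" "A \<union> B = verts G" "A \<inter> B = {}"
  shows "uncut_on_fibres G p (\<lambda>x. x \<in> A)"
  unfolding uncut_on_fibres_def
proof (intro allI impI)
  fix x y assume xy: "{x, y} \<in> edges G" "p x = p y"
  have D: "D \<in> vertex_partitions G" using AB unfolding vertex_partitions_def by blast
  have "\<not> separates D x y"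
    using assms(1) xy Cut_iff_separates[OF G D xy(1)] unfolding pushable_def by blast
  then show "(x \<in> A) = (y \<in> A)"
    using separates_iff[OF AB(2,3)] simple_graph_edgeD[OF G xy(1)] AB(1) by blast
qed

text \<open>The lift is chosen before \<open>D\<close>, so one edge serves all pushable partitions.
  It comes from \<open>cut_retract\<close>, since a part of a pushable partition is an admissible
  \<open>\<sigma>\<close>.\<close>

lemma edge_lift:
  assumes "e \<in> edges H"
  shows "\<exists>e'\<in>edges G. \<forall>D\<in>vertex_partitions G. pushable D \<longrightarrow> (e' \<in> Cut G D \<longleftrightarrow> cuts (push D) e)"
proof -
  obtain a c where ac: "e = {a, c}" using simple_graph_edgeE[OF H assms] by blast
  then have e: "{a, c} \<in> edges H" using assms by simp
  obtain x y where xy: "{x, y} \<in> edges G"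
    "\<And>\<sigma>. uncut_on_fibres G p \<sigma> \<Longrightarrow> \<sigma> x = \<sigma> (j a) \<and> \<sigma> y = \<sigma> (j c)"
    using retract e unfolding cut_retract_def by blast
  have "{x, y} \<in> Cut G D \<longleftrightarrow> cuts (push D) e" if D: "D \<in> vertex_partitions G" "pushable D" for D
  proof -
    obtain A B where AB: "D = {A, B}" "A \<union> B = verts G" "A \<inter> B = {}"
      using D(1) by (rule vertex_partitionE)
    have "{x, y} \<in> Cut G D \<longleftrightarrow> separates D x y" by (rule Cut_iff_separates[OF G D(1) xy(1)])
    also have "\<dots> \<longleftrightarrow> (x \<in> A) \<noteq> (y \<in> A)"
      using separates_iff[OF AB(2,3)] simple_graph_edgeD[OF G xy(1)] AB(1) by blast
    also have "\<dots> \<longleftrightarrow> (j a \<in> A) \<noteq> (j c \<in> A)"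
      using xy(2)[OF uncut_on_fibres_pushable[OF D(2) AB]] by blast
    also have "\<dots> \<longleftrightarrow> separates D (j a) (j c)"
      using separates_iff[OF AB(2,3)] j_verts edge_H_verts[OF e] AB(1) by blast
    also have "\<dots> \<longleftrightarrow> cuts (push D) e"
      using side_push[OF D(1)] edge_H_verts[OF e] unfolding ac cuts_edge by blast
    finally show ?thesis .
  qed
  then show ?thesis using xy(1) by blast
qed

section \<open>The homomorphism \<rho> on the cut ideal\<close>

definition push_var :: "'v set set \<Rightarrow> (bool \<times> bool \<times> bool, 'k::field) mpoly" where
  "push_var D = (if pushable D then pvar (push D) else 0)"

lemma homogeneous_push_var: "homogeneous 1 (push_var D)"
  by (simp add: push_var_def homogeneous_pvar del: One_nat_def)

lemma push_var_pull: "push_var (pull b) = pvar b"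
  by (simp add: push_var_def pushable_pull push_pull)

text \<open>The outer substitution is the cut map of \<open>H\<close> with all t-variables set to 1.
  After \<rho> it factors through the cut map of \<open>G\<close> by way of \<open>\<theta>\<close>,
  which sends t-variables to 1, s-variables of collapsed edges to 0, and any other s-variable to the
  product over the edges of \<open>H\<close> lifted to its edge. The value 0 of
  \<open>push_var\<close> matches the zeros of \<open>\<theta>\<close>.\<close>

lemma poly_subst_push_cut_ideal:
  assumes "g \<in> (cut_ideal G :: ('v set set, 'k::field) mpoly set)"
  shows "poly_subst (\<lambda>b. \<Prod>e\<in>{e \<in> edges H. cuts b e}. pvar e) (poly_subst push_var g) = 0"
proof -
  obtain \<epsilon> where \<epsilon>: "\<And>e. e \<in> edges H \<Longrightarrow> \<epsilon> e \<in> edges G"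
    "\<And>e D. e \<in> edges H \<Longrightarrow> D \<in> vertex_partitions G \<Longrightarrow> pushable D \<Longrightarrow> \<epsilon> e \<in> Cut G D \<longleftrightarrow> cuts (push D) e"
    using edge_lift by metis
  define \<theta> :: "'v set st_var \<Rightarrow> (nat set, 'k) mpoly" where
    "\<theta> z = (case z of
        S_var e \<Rightarrow> if \<exists>x y. e = {x, y} \<and> p x = p y then 0 else \<Prod>e'\<in>{e' \<in> edges H. \<epsilon> e' = e}. pvar e'
      | T_var e \<Rightarrow> 1)" for z
  have eq: "poly_subst \<theta> (cut_monomial G D)
      = poly_subst (\<lambda>b. \<Prod>e\<in>{e \<in> edges H. cuts b e}. pvar e) (push_var D)"
    if D: "D \<in> vertex_partitions G" for D
  proof -
    have lhs: "poly_subst \<theta> (cut_monomial G D) = (\<Prod>e\<in>Cut G D. \<theta> (S_var e))"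
      by (simp add: poly_subst_mult poly_subst_prod \<theta>_def)
    show ?thesis
    proof (cases "pushable D")
      case False
      then obtain x y where "{x, y} \<in> Cut G D" "p x = p y" unfolding pushable_def by blast
      then have "\<theta> (S_var {x, y}) = 0" "{x, y} \<in> Cut G D" by (auto simp: \<theta>_def)
      then have "(\<Prod>e\<in>Cut G D. \<theta> (S_var e)) = 0" by (intro prod_zero) auto
      then show ?thesis using False by (simp only: lhs push_var_def if_False poly_subst_0)
    next
      case True
      let ?S = "{e' \<in> edges H. \<epsilon> e' \<in> Cut G D}"
      have "(\<Prod>e\<in>Cut G D. \<theta> (S_var e))
          = (\<Prod>e\<in>Cut G D. \<Prod>e'\<in>{e' \<in> ?S. \<epsilon> e' = e}. pvar e')"
      proof (rule prod.cong[OF refl])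
        fix e assume e: "e \<in> Cut G D"
        then have "\<not> (\<exists>x y. e = {x, y} \<and> p x = p y)" using True unfolding pushable_def by blast
        moreover have "{e' \<in> edges H. \<epsilon> e' = e} = {e' \<in> ?S. \<epsilon> e' = e}" using e by blast
        ultimately show "\<theta> (S_var e) = (\<Prod>e'\<in>{e' \<in> ?S. \<epsilon> e' = e}. pvar e')"
          by (simp only: \<theta>_def st_var.case if_False)
      qed
      \<comment> \<open>The fibres of \<open>\<epsilon>\<close> over the cut edges partition
        \<open>?S\<close>.\<close>
      also have "\<dots> = (\<Prod>e'\<in>?S. pvar e')"
        by (rule prod.group) auto
      also have "?S = {e \<in> edges H. cuts (push D) e}" using \<epsilon>(2)[OF _ D True] by blast
      finally show ?thesis using True by (simp only: lhs push_var_def if_True poly_subst_pvar)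
    qed
  qed
  have g: "g \<in> carrier (poly_ring (vertex_partitions G))" "poly_subst (cut_monomial G) g = 0"
    using assms unfolding cut_ideal_def a_kernel_def' cut_map_def by (simp_all add: poly_ring_def)
  have "0 = poly_subst \<theta> (poly_subst (cut_monomial G) g)" by (simp only: g poly_subst_0)
  also have "\<dots> = poly_subst (\<lambda>D. poly_subst (\<lambda>b. \<Prod>e\<in>{e \<in> edges H. cuts b e}. pvar e) (push_var D)) g"
    unfolding poly_subst_poly_subst by (rule poly_subst_cong[OF g(1) eq])
  finally show ?thesis by (simp only: poly_subst_poly_subst)
qed

text \<open>Here \<open>\<kappa> b\<close> is the squarefree exponent vector of the edges of
  \<open>H\<close> cut by \<open>b\<close>. Equal sums of two such vectors mean
  \<open>same_cuts\<close>, so \<open>uniq\<close> isolates the monomial.\<close>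

lemma lookup_push_cut_ideal:
  fixes g :: "('v set set, 'k::field) mpoly"
  assumes g: "g \<in> cut_ideal G" "homogeneous 2 g"
    and uniq: "\<And>c d. same_cuts H c d a b \<Longrightarrow> (c = a \<and> d = b) \<or> (c = b \<and> d = a)"
  shows "Poly_Mapping.lookup (poly_subst push_var g)
    (Poly_Mapping.single a 1 + Poly_Mapping.single b 1) = 0"
proof -
  define \<kappa> :: "bool \<times> bool \<times> bool \<Rightarrow> nat set \<Rightarrow>\<^sub>0 nat" where
    "\<kappa> b = (\<Sum>e\<in>{e \<in> edges H. cuts b e}. Poly_Mapping.single e 1)" for b
  have monom: "(\<Prod>e\<in>E. pvar e :: (nat set, 'k) mpoly) = Poly_Mapping.single (\<Sum>e\<in>E. Poly_Mapping.single e 1) 1"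
    for E by (induction E rule: infinite_finite_induct) (simp_all add: pvar_def mult_single)
  have \<kappa>: "Poly_Mapping.lookup (\<kappa> b) e = of_bool (cuts b e)" if "e \<in> edges H" for b e
    using that by (simp add: \<kappa>_def lookup_sum lookup_single when_def sum.delta)
  show ?thesis
  proof (rule lookup_eq_0_if_monom_subst_zero[where \<kappa> = \<kappa>])
    show "homogeneous 2 (poly_subst push_var g)"
      using g(2) homogeneous_push_var by (rule homogeneous_poly_subst)
    show "poly_subst (\<lambda>b. Poly_Mapping.single (\<kappa> b) 1) (poly_subst push_var g) = 0"
      using poly_subst_push_cut_ideal[OF g(1)] unfolding monom \<kappa>_def .
    fix c d assume eq: "\<kappa> c + \<kappa> d = \<kappa> a + \<kappa> b"
    show "(c = a \<and> d = b) \<or> (c = b \<and> d = a)"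
    proof (rule uniq)
      have "of_bool (cuts c e) + of_bool (cuts d e) = (of_bool (cuts a e) + of_bool (cuts b e) :: nat)"
        if "e \<in> edges H" for e
        unfolding \<kappa>[OF that, symmetric] lookup_add[symmetric] eq ..
      then show "same_cuts H c d a b"
        by (simp only: same_cuts_def of_bool_add_eq_iff ball_simps) blast
    qed
  qed
qed

section \<open>Pullbacks of binomials\<close>

definition pull_binomial :: "(bool \<times> bool \<times> bool) list \<Rightarrow> (bool \<times> bool \<times> bool) list \<Rightarrow>
    ('v set set, 'k::field) mpoly" where
  "pull_binomial bs cs = (\<Prod>b\<leftarrow>bs. pvar (pull b)) - (\<Prod>b\<leftarrow>cs. pvar (pull b))"

lemma push_pull_binomial:
  "poly_subst push_var (pull_binomial bs cs) = (\<Prod>b\<leftarrow>bs. pvar b) - (\<Prod>b\<leftarrow>cs. pvar b)"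
  by (simp add: pull_binomial_def poly_subst_minus poly_subst_prod_list comp_def push_var_pull)

text \<open>An edge of \<open>G\<close> over an edge of \<open>H\<close> is cut by a pullback
  exactly when its image is cut, so \<open>eq\<close> balances its variables. A collapsed edge is
  never cut, and equal lengths balance the powers of its t-variable.\<close>

lemma pull_binomial_cut_ideal:
  assumes "length bs = length cs"
    and eq: "\<And>e. e \<in> edges H \<Longrightarrow> mset (map (\<lambda>b. cuts b e) bs) = mset (map (\<lambda>b. cuts b e) cs)"
  shows "pull_binomial bs cs \<in> (cut_ideal G :: ('v set set, 'k::field) mpoly set)"
proof -
  let ?z = "\<lambda>e c. if c then pvar (S_var e) else pvar (T_var e) :: ('v set st_var, 'k) mpoly"
  \<comment> \<open>One factor per edge allows the products over cuts and over edges to be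
    exchanged.\<close>
  have mon: "cut_monomial G D = (\<Prod>e\<in>edges G. ?z e (e \<in> Cut G D))" for D
  proof -
    have "edges G \<inter> {e. e \<in> Cut G D} = Cut G D" "edges G \<inter> - {e. e \<in> Cut G D} = edges G - Cut G D"
      by (auto simp: Cut_def)
    then show ?thesis by (simp add: prod.If_cases)
  qed
  have image: "poly_subst (cut_monomial G) (\<Prod>b\<leftarrow>bs. pvar (pull b))
      = (\<Prod>e\<in>edges G. prod_mset (image_mset (?z e) (mset (map (\<lambda>b. e \<in> Cut G (pull b)) bs))))" for bs
  proof -
    have "poly_subst (cut_monomial G) (\<Prod>b\<leftarrow>bs. pvar (pull b))
        = (\<Prod>b\<leftarrow>bs. cut_monomial G (pull b) :: (_, 'k) mpoly)"
      by (simp add: poly_subst_prod_list comp_def)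
    also have "\<dots> = (\<Prod>e\<in>edges G. \<Prod>b\<leftarrow>bs. ?z e (e \<in> Cut G (pull b)))"
      unfolding mon by (rule prod_list_prod)
    moreover have "(\<Prod>b\<leftarrow>bs. ?z e (e \<in> Cut G (pull b)))
        = prod_mset (image_mset (?z e) (mset (map (\<lambda>b. e \<in> Cut G (pull b)) bs)))" for e
      by (simp only: mset_map[symmetric] map_map comp_def prod_mset_prod_list)
    ultimately show ?thesis by (simp only:)
  qed
  have "mset (map (\<lambda>b. e \<in> Cut G (pull b)) bs) = mset (map (\<lambda>b. e \<in> Cut G (pull b)) cs)"
    if e: "e \<in> edges G" for e
  proof -
    obtain x y where xy: "e = {x, y}" using simple_graph_edgeE[OF G e] by blast
    then have E: "{x, y} \<in> edges G" using e by simp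
    show ?thesis
    proof (cases "p x = p y")
      case True
      then have "e \<notin> Cut G (pull b)" for b using Cut_pull[OF E] xy by simp
      then show ?thesis using assms(1) by (simp add: map_replicate_const)
    next
      case False
      then have "{p x, p y} \<in> edges H" using retract E unfolding cut_retract_def by blast
      from eq[OF this] show ?thesis unfolding xy Cut_pull[OF E] cuts_edge .
    qed
  qed
  then have "poly_subst (cut_monomial G) (\<Prod>b\<leftarrow>bs. pvar (pull b) :: (_, 'k) mpoly)
      = poly_subst (cut_monomial G) (\<Prod>b\<leftarrow>cs. pvar (pull b))"
    unfolding image by (intro prod.cong) simp_all
  moreover have "(\<Prod>b\<leftarrow>bs. pvar (pull b) :: (_, 'k) mpoly) \<in> carrier (poly_ring (vertex_partitions G))" for bs
    by (rule poly_ring_prod_list) (auto intro: poly_ring_pvar pull_partition)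
  ultimately show ?thesis
    unfolding cut_ideal_def a_kernel_def' cut_map_def pull_binomial_def
    by (simp add: poly_subst_minus poly_ring_minus) (simp add: poly_ring_def)
qed

lemma homogeneous_pull_binomial:
  "homogeneous 2 (pull_binomial [a, b] [c, d] :: ('v set set, 'k::field) mpoly)"
proof -
  have "homogeneous 2 (pvar u * pvar v :: ('v set set, 'k) mpoly)" for u v
    using homogeneous_mult[OF homogeneous_pvar homogeneous_pvar] by (simp add: numeral_2_eq_2)
  then show ?thesis by (simp add: pull_binomial_def homogeneous_minus)
qed

section \<open>The three target graphs\<close>

lemma not_property_N_K4:
  assumes K4: "edges H = edges K4"
  shows "\<not> property_N (vertex_partitions G) 1 (cut_ideal G :: ('v set set, 'k::field) mpoly set)"
proof
  assume N: "property_N (vertex_partitions G) 1 (cut_ideal G :: ('v set set, 'k) mpoly set)"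
  have quadric: "poly_subst push_var u = 0" if u: "u \<in> (cut_ideal G :: ('v set set, 'k) mpoly set)" "homogeneous 2 u" for u
  proof (rule ccontr)
    assume "\<not> ?thesis"
    then obtain m where m: "Poly_Mapping.lookup (poly_subst push_var u) m \<noteq> 0"
      by (rule lookup_nonzeroE)
    have "homogeneous 2 (poly_subst push_var u)"
      using u(2) homogeneous_push_var by (rule homogeneous_poly_subst)
    then have "mdeg m = 2" using m by (simp add: homogeneous_def in_keys_iff)
    then obtain a b where ab: "m = Poly_Mapping.single a 1 + Poly_Mapping.single b 1"
      by (rule mdeg_2E)
    have "Poly_Mapping.lookup (poly_subst push_var u) (Poly_Mapping.single a 1 + Poly_Mapping.single b 1) = 0"
    proof (rule lookup_push_cut_ideal[OF u])
      show "(c = a \<and> d = b) \<or> (c = b \<and> d = a)" if "same_cuts H c d a b" for c d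
        \<comment> \<open>In \<open>K4\<close> the edge multiplicities determine an unordered pair
          of cuts; this is checked propositionally in the twelve bits.\<close>
        using that by (cases a; cases b; cases c; cases d)
          (simp add: same_cuts_def K4 K4_def cuts_edge mset_bool_pair_eq_iff, argo)
    qed
    then show False using m ab by simp
  qed
  txt \<open>The cut ideal of \<open>K\<^sub>4\<close> is generated by the following quartic binomial.\<close>
  let ?bs = "[(False, False, False), (False, True, True), (True, False, True), (True, True, False)]"
  let ?cs = "[(True, True, True), (True, False, False), (False, True, False), (False, False, True)]"
  \<comment> \<open>Every edge of \<open>K4\<close> is cut by exactly two members of each
    list.\<close>
  have "pull_binomial ?bs ?cs \<in> (cut_ideal G :: ('v set set, 'k) mpoly set)"
    by (rule pull_binomial_cut_ideal) (auto simp: K4 K4_def cuts_edge)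
  from poly_subst_eq_0_if_quadrics[OF N quadric this]
  have "(\<Prod>b\<leftarrow>?bs. pvar b) = (\<Prod>b\<leftarrow>?cs. pvar b :: (_, 'k) mpoly)"
    by (simp only: push_pull_binomial right_minus_eq)
  then have "Poly_Mapping.single (\<Sum>b\<leftarrow>?bs. Poly_Mapping.single b (1::nat)) (1::'k)
      = Poly_Mapping.single (\<Sum>b\<leftarrow>?cs. Poly_Mapping.single b 1) 1"
    by (simp add: pvar_def mult_single)
  then have "Poly_Mapping.keys (Poly_Mapping.single (\<Sum>b\<leftarrow>?bs. Poly_Mapping.single b (1::nat)) (1::'k))
      = Poly_Mapping.keys (Poly_Mapping.single (\<Sum>b\<leftarrow>?cs. Poly_Mapping.single b (1::nat)) (1::'k))"
    by (simp only:)
  then have "(\<Sum>b\<leftarrow>?bs. Poly_Mapping.single b (1::nat)) = (\<Sum>b\<leftarrow>?cs. Poly_Mapping.single b 1)"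
    by simp
  \<comment> \<open>The empty cut occurs in \<open>?bs\<close> but not in
    \<open>?cs\<close>.\<close>
  then have "Poly_Mapping.lookup (\<Sum>b\<leftarrow>?bs. Poly_Mapping.single b (1::nat)) (False, False, False)
      = Poly_Mapping.lookup (\<Sum>b\<leftarrow>?cs. Poly_Mapping.single b 1) (False, False, False)"
    by (simp only:)
  then show False by (simp add: lookup_add lookup_single)
qed

text \<open>Assumptions \<open>x\<close> and \<open>y\<close> isolate the product of these two
  variables in all quadrics after \<rho>. Assumption \<open>1\<close> gives a binomial with leading
  coefficient 1 at that product, and \<open>2\<close> one that avoids it; \<open>a\<^sub>2\<close>
  differing from \<open>a\<^sub>3\<close> and \<open>b\<^sub>3\<close> keeps the latter
  nonzero.\<close>

lemma not_property_N_koszul: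
  assumes "x \<noteq> y"
    and x: "\<And>z c d. z \<noteq> y \<Longrightarrow> same_cuts H c d z x \<Longrightarrow> (c = z \<and> d = x) \<or> (c = x \<and> d = z)"
    and y: "\<And>z c d. z \<noteq> x \<Longrightarrow> same_cuts H c d z y \<Longrightarrow> (c = z \<and> d = y) \<or> (c = y \<and> d = z)"
    and 1: "same_cuts H x y a\<^sub>1 b\<^sub>1" "a\<^sub>1 \<notin> {x, y}"
    and 2: "same_cuts H a\<^sub>2 b\<^sub>2 a\<^sub>3 b\<^sub>3" "a\<^sub>2 \<notin> {x, y, a\<^sub>3, b\<^sub>3}" "a\<^sub>3 \<notin> {x, y}"
  shows "\<not> property_N (vertex_partitions G) 1 (cut_ideal G :: ('v set set, 'k::field) mpoly set)"
proof
  assume N: "property_N (vertex_partitions G) 1 (cut_ideal G :: ('v set set, 'k) mpoly set)"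
  let ?F1 = "pull_binomial [x, y] [a\<^sub>1, b\<^sub>1] :: (_, 'k) mpoly"
  let ?F2 = "pull_binomial [a\<^sub>2, b\<^sub>2] [a\<^sub>3, b\<^sub>3] :: (_, 'k) mpoly"
  have push: "poly_subst push_var (pull_binomial [a, b] [c, d])
      = pvar a * pvar b - (pvar c * pvar d :: (_, 'k) mpoly)" for a b c d
    by (simp add: push_pull_binomial)
  have coeff: "Poly_Mapping.lookup (poly_subst push_var (pull_binomial [a, b] [c, d]) :: (_, 'k) mpoly)
      (Poly_Mapping.single u 1 + Poly_Mapping.single v 1)
    = of_bool ((a = u \<and> b = v) \<or> (a = v \<and> b = u)) - of_bool ((c = u \<and> d = v) \<or> (c = v \<and> d = u))"
    for a b c d u v unfolding push lookup_minus lookup_pvar_mult ..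
  show False
  proof (rule isolated_monomial_not_property_N[where F\<^sub>1 = ?F1 and F\<^sub>2 = ?F2,
      OF N _ homogeneous_push_var \<open>x \<noteq> y\<close>])
    show "cut_ideal G \<subseteq> carrier (poly_ring (vertex_partitions G))"
      unfolding cut_ideal_def a_kernel_def' by blast
    show "?F1 \<in> cut_ideal G" "?F2 \<in> cut_ideal G"
      using 1(1) 2(1) by (auto intro!: pull_binomial_cut_ideal simp: same_cuts_def)
    show "homogeneous 2 ?F1" "homogeneous 2 ?F2" by (rule homogeneous_pull_binomial)+
    show "Poly_Mapping.lookup (poly_subst push_var ?F1) (Poly_Mapping.single x 1 + Poly_Mapping.single y 1) \<noteq> 0"
      "Poly_Mapping.lookup (poly_subst push_var ?F2) (Poly_Mapping.single x 1 + Poly_Mapping.single y 1) = 0"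
      unfolding coeff using 1(2) 2(2,3) by auto
    have "Poly_Mapping.lookup (poly_subst push_var ?F2) (Poly_Mapping.single a\<^sub>2 1 + Poly_Mapping.single b\<^sub>2 1) \<noteq> 0"
      unfolding coeff using 2(2) by auto
    then show "poly_subst push_var ?F2 \<noteq> 0" by (metis lookup_zero)
  next
    fix u :: "(_, 'k) mpoly" and z assume u: "u \<in> cut_ideal G" "homogeneous 2 u"
    show "Poly_Mapping.lookup (poly_subst push_var u) (Poly_Mapping.single z 1 + Poly_Mapping.single x 1) = 0"
      if "z \<noteq> y" using u x[OF that] by (rule lookup_push_cut_ideal)
    show "Poly_Mapping.lookup (poly_subst push_var u) (Poly_Mapping.single z 1 + Poly_Mapping.single y 1) = 0"
      if "z \<noteq> x" using u y[OF that] by (rule lookup_push_cut_ideal)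
  qed
qed

text \<open>
  The eight cuts of the 4-cycle form four complementary pairs, and the cut ideal identifies the
  products over these pairs; \<open>?x\<close> is the empty cut and \<open>?y\<close> the full one.
\<close>
lemma not_property_N_C4:
  assumes C4: "edges H = edges C4"
  shows "\<not> property_N (vertex_partitions G) 1 (cut_ideal G :: ('v set set, 'k::field) mpoly set)"
proof (rule not_property_N_koszul)
  let ?x = "(False, False, False)" and ?y = "(True, False, True)"
  show "(c = z \<and> d = ?x) \<or> (c = ?x \<and> d = z)" if "z \<noteq> ?y" "same_cuts H c d z ?x" for z c d
    using that by (cases z; cases c; cases d)
      (simp add: same_cuts_def C4 C4_def cuts_edge mset_bool_pair_eq_iff, argo)
  show "(c = z \<and> d = ?y) \<or> (c = ?y \<and> d = z)" if "z \<noteq> ?x" "same_cuts H c d z ?y" for z c d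
    using that by (cases z; cases c; cases d)
      (simp add: same_cuts_def C4 C4_def cuts_edge mset_bool_pair_eq_iff, argo)
  \<comment> \<open>\<open>?a\<close> and \<open>?b\<close> each cut a pair of opposite edges; their
    product is the second term of both binomials.\<close>
  let ?a = "(True, True, False)" and ?b = "(False, True, True)"
  show "same_cuts H ?x ?y ?a ?b" "same_cuts H (True, False, False) (False, False, True) ?a ?b"
    by (simp_all add: same_cuts_def C4 C4_def cuts_edge mset_bool_pair_eq_iff)
qed auto

text \<open>
  The cut ideal is generated by two binomials in disjoint sets of variables: those of the cuts
  that avoid the edge \<open>{2, 3}\<close>, and those of the cuts that contain it.
\<close>
lemma not_property_N_K4_minus_edge:
  assumes "edges H = edges K4_minus_edge"
  shows "\<not> property_N (vertex_partitions G) 1 (cut_ideal G :: ('v set set, 'k::field) mpoly set)"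
proof (rule not_property_N_koszul)
  have H: "edges H = {{0, 2}, {0, 3}, {1, 2}, {1, 3}, {2, 3}}"
    using assms by (simp add: K4_minus_edge_eq)
  \<comment> \<open>\<open>?x\<close> cuts nothing, and \<open>?y\<close> cuts the 4-cycle left
    after removing \<open>{2, 3}\<close>.\<close>
  let ?x = "(False, False, False)" and ?y = "(False, True, True)"
  show "(c = z \<and> d = ?x) \<or> (c = ?x \<and> d = z)" if "z \<noteq> ?y" "same_cuts H c d z ?x" for z c d
    using that by (cases z; cases c; cases d)
      (simp add: same_cuts_def H cuts_edge mset_bool_pair_eq_iff, argo)
  show "(c = z \<and> d = ?y) \<or> (c = ?y \<and> d = z)" if "z \<noteq> ?x" "same_cuts H c d z ?y" for z c d
    using that by (cases z; cases c; cases d)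
      (simp add: same_cuts_def H cuts_edge mset_bool_pair_eq_iff, argo)
  show "same_cuts H ?x ?y (True, True, True) (True, False, False)"
    "same_cuts H (False, True, False) (False, False, True) (True, False, True) (True, True, False)"
    by (simp_all add: same_cuts_def H cuts_edge mset_bool_pair_eq_iff)
qed auto

end

theorem corollary6p15:
  fixes G :: "'v graph"
  assumes "simple_graph G"
    and "card (edges G) \<ge> 1"
    and "property_N (vertex_partitions G) 1
           (cut_ideal G :: ('v set set, 'k::field) mpoly set)"
  shows "combinatorial_retract_free G {K4, K4_minus_edge, C4}"
  unfolding combinatorial_retract_free_def
proof (intro ballI notI)
  fix H assume H_cases: "H \<in> {K4, K4_minus_edge, C4}"
    and "\<exists>G'. combinatorial_retract G G' \<and> graph_iso G' H"
  then obtain G' where G': "combinatorial_retract G G'" "graph_iso G' H" by blast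
  obtain p\<^sub>1 j\<^sub>1 where 1: "simple_graph G'" "cut_retract G G' p\<^sub>1 j\<^sub>1"
    using combinatorial_retract_cut_retract[OF G'(1) assms(1)] by blast
  \<comment> \<open>The isomorphism is one more retract, so the composite ends in the concrete graph
    on \<open>{0, 1, 2, 3}\<close>.\<close>
  obtain p\<^sub>2 j\<^sub>2 where 2: "cut_retract G' H p\<^sub>2 j\<^sub>2"
    using graph_iso_cut_retract[OF G'(2) 1(1)] by blast
  have verts: "verts H = {0, 1, 2, 3}"
    using H_cases by (auto simp: K4_def K4_minus_edge_def C4_def)
  have "simple_graph H"
    using H_cases by (elim insertE emptyE) (simp_all add: simple_graph_def K4_def K4_minus_edge_eq C4_def)
  with 1 2 assms(1) verts have "four_vertex_retract G H (p\<^sub>2 \<circ> p\<^sub>1) (j\<^sub>1 \<circ> j\<^sub>2)"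
    by (simp add: four_vertex_retract_def cut_retract_trans)
  then interpret four_vertex_retract G H "p\<^sub>2 \<circ> p\<^sub>1" "j\<^sub>1 \<circ> j\<^sub>2" .
  show False
    using H_cases assms(3) not_property_N_K4 not_property_N_K4_minus_edge not_property_N_C4 by blast
qed

end
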